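(* If $\Phi$ is a root system of type $A_\ell$ with positive system $\Phi^+$, then every Worpitzky-compatible subset of $\Phi^+$ is strongly compatible; i.e. the sets of compatible and strongly compatible subsets of $\Phi^+$ coincide.
   Context: $V$ is a Euclidean space with inner product $(\cdot,\cdot)$, $\Phi\subseteq V$ a root system of type $A_\ell$, $\Phi^+$ a positive system with simple roots $\alpha_1,\dots,\alpha_\ell$. For $\alpha\in\Phi$, $m\in\mathbb{Z}$, $H_{\alpha,m}=\{x\in V\mid(\alpha,x)=m\}$. $\Psi\subseteq\Phi^+$ is strongly compatible if for every $\alpha\in\Psi$ and any positive roots $\beta_1,\dots,\beta_m\in\Phi^+$ with $\alpha\in\sum_{i=1}^m\mathbb{Z}_{>0}\beta_i$, some $\beta_k\in\Psi$. An alcove is a connected component of $V\setminus\bigcup_{\alpha\in\Phi^+,m\in\mathbb{Z}}H_{\alpha,m}$; walls of $A$ are hyperplanes supporting a facet of $A$; ceilings are walls not through the origin with the origin on the same side as $A$; the upper closure $A^\diamondsuit$ is $A$ together with its facets supported by ceilings. $P^\diamondsuit=\{x\in V\mid 0<(\alpha_i,x)\le1\ \forall i\}$. $\Psi\subseteq\Phi^+$ is Worpitzky-compatible if for every alcove $A\subseteq P^\diamondsuit$, every $\alpha\in\Psi$, $m\in\mathbb{Z}$, the set $A^\diamondsuit\cap H_{\alpha,m}$ is empty or contained in a ceiling $H_{\beta,m'}$ of $A$ with $\beta\in\Psi$, $m'\in\mathbb{Z}$. *)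

theory Defs
  imports "HOL-Analysis.Analysis"
begin

definition root_reflection :: "'a::euclidean_space \<Rightarrow> 'a \<Rightarrow> 'a" where
  "root_reflection \<alpha> x = x - (2 * (x \<bullet> \<alpha>) / (\<alpha> \<bullet> \<alpha>)) *\<^sub>R \<alpha>"

definition root_system :: "'a::euclidean_space set \<Rightarrow> bool" where
  "root_system \<Phi> \<longleftrightarrow>
     finite \<Phi> \<and> 0 \<notin> \<Phi> \<and> span \<Phi> = UNIV \<and>
     (\<forall>\<alpha>\<in>\<Phi>. {c *\<^sub>R \<alpha> | c. c *\<^sub>R \<alpha> \<in> \<Phi>} = {\<alpha>, - \<alpha>}) \<and>
     (\<forall>\<alpha>\<in>\<Phi>. root_reflection \<alpha> ` \<Phi> = \<Phi>) \<and>
     (\<forall>\<alpha>\<in>\<Phi>. \<forall>\<beta>\<in>\<Phi>. 2 * (\<beta> \<bullet> \<alpha>) / (\<alpha> \<bullet> \<alpha>) \<in> \<int>)"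

definition root_base :: "'a::euclidean_space set \<Rightarrow> 'a set \<Rightarrow> bool" where
  "root_base \<Phi> \<Delta> \<longleftrightarrow>
     \<Delta> \<subseteq> \<Phi> \<and> independent \<Delta> \<and> span \<Delta> = UNIV \<and>
     (\<forall>\<beta>\<in>\<Phi>. \<exists>c :: 'a \<Rightarrow> int. \<beta> = (\<Sum>\<alpha>\<in>\<Delta>. of_int (c \<alpha>) *\<^sub>R \<alpha>) \<and>
        ((\<forall>\<alpha>\<in>\<Delta>. 0 \<le> c \<alpha>) \<or> (\<forall>\<alpha>\<in>\<Delta>. c \<alpha> \<le> 0)))"

text \<open>The positive system whose simple roots are the elements of the base \<open>\<Delta>\<close>.\<close>

definition positive_roots :: "'a::euclidean_space set \<Rightarrow> 'a set \<Rightarrow> 'a set" where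
  "positive_roots \<Phi> \<Delta> =
     {\<beta>\<in>\<Phi>. \<exists>c :: 'a \<Rightarrow> nat. \<beta> = (\<Sum>\<alpha>\<in>\<Delta>. of_nat (c \<alpha>) *\<^sub>R \<alpha>)}"

text \<open>Some base can be numbered so that its Cartan matrix is the one of type \<open>A\<^sub>\<ell>\<close>. Being of type
  \<open>A\<^sub>\<ell>\<close> is thus a property of \<open>\<Phi>\<close> alone; the length of the roots is not normalised.\<close>

definition root_system_type_A :: "nat \<Rightarrow> 'a::euclidean_space set \<Rightarrow> bool" where
  "root_system_type_A l \<Phi> \<longleftrightarrow>
     root_system \<Phi> \<and> 1 \<le> l \<and>
     (\<exists>\<Delta> (\<alpha> :: nat \<Rightarrow> 'a). root_base \<Phi> \<Delta> \<and> bij_betw \<alpha> {1..l} \<Delta> \<and>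
        (\<forall>i\<in>{1..l}. \<forall>j\<in>{1..l}.
           2 * (\<alpha> i \<bullet> \<alpha> j) / (\<alpha> j \<bullet> \<alpha> j) =
             (if i = j then 2 else if i = j + 1 \<or> j = i + 1 then -1 else 0)))"

definition root_hyperplane :: "'a::euclidean_space \<Rightarrow> int \<Rightarrow> 'a set" where
  "root_hyperplane \<alpha> m = {x. \<alpha> \<bullet> x = of_int m}"

definition alcoves :: "'a::euclidean_space set \<Rightarrow> 'a set set" where
  "alcoves \<Phi>p = components (UNIV - (\<Union>\<alpha>\<in>\<Phi>p. \<Union>m. root_hyperplane \<alpha> m))"

text \<open>A facet spans the unique hyperplane supporting it.\<close>

definition walls :: "'a::euclidean_space set \<Rightarrow> 'a set set" where
  "walls A = {affine hull F | F. F facet_of closure A}"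

text \<open>The half-space \<open>a \<bullet> x < b\<close> with \<open>b > 0\<close> is the side of the wall containing the origin.\<close>

definition ceilings :: "'a::euclidean_space set \<Rightarrow> 'a set set" where
  "ceilings A = {H \<in> walls A. \<exists>a b. H = {x. a \<bullet> x = b} \<and> 0 < b \<and> (\<forall>x\<in>A. a \<bullet> x < b)}"

text \<open>The facets added to \<open>A\<close> are half-open: they contain their common faces with other ceilings,
  but no point of a wall that is not a ceiling. In other words, the upper closure is cut out by
  \<open>a \<bullet> x \<le> b\<close> for its ceilings and by strict inequalities for its other walls. This is the
  convention under which the upper closures of the alcoves in the fundamental parallelepiped
  partition it.\<close>

definition upper_closure :: "'a::euclidean_space set \<Rightarrow> 'a set" where
  "upper_closure A = A \<union> (\<Union>H\<in>ceilings A. (closure A \<inter> H) - \<Union>(walls A - ceilings A))"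

definition fundamental_parallelepiped :: "'a::euclidean_space set \<Rightarrow> 'a set" where
  "fundamental_parallelepiped \<Delta> = {x. \<forall>\<alpha>\<in>\<Delta>. 0 < \<alpha> \<bullet> x \<and> \<alpha> \<bullet> x \<le> 1}"

definition worpitzky_compatible ::
    "'a::euclidean_space set \<Rightarrow> 'a set \<Rightarrow> 'a set \<Rightarrow> bool" where
  "worpitzky_compatible \<Phi>p \<Delta> \<Psi> \<longleftrightarrow>
     \<Psi> \<subseteq> \<Phi>p \<and>
     (\<forall>A\<in>alcoves \<Phi>p. A \<subseteq> fundamental_parallelepiped \<Delta> \<longrightarrow>
        (\<forall>\<alpha>\<in>\<Psi>. \<forall>m. upper_closure A \<inter> root_hyperplane \<alpha> m = {} \<or>
           (\<exists>\<beta>\<in>\<Psi>. \<exists>m'. root_hyperplane \<beta> m' \<in> ceilings A \<and>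
              upper_closure A \<inter> root_hyperplane \<alpha> m \<subseteq> root_hyperplane \<beta> m')))"

definition strongly_compatible :: "'a::euclidean_space set \<Rightarrow> 'a set \<Rightarrow> bool" where
  "strongly_compatible \<Phi>p \<Psi> \<longleftrightarrow>
     \<Psi> \<subseteq> \<Phi>p \<and>
     (\<forall>\<alpha>\<in>\<Psi>. \<forall>(m::nat) (\<beta> :: nat \<Rightarrow> 'a) (c :: nat \<Rightarrow> nat).
        (\<forall>i\<in>{1..m}. \<beta> i \<in> \<Phi>p \<and> 0 < c i) \<and> \<alpha> = (\<Sum>i=1..m. of_nat (c i) *\<^sub>R \<beta> i) \<longrightarrow>
        (\<exists>k\<in>{1..m}. \<beta> k \<in> \<Psi>))"

end

(* Choose v_0, ..., v_l with simple roots v_i - v_(i+1) and positive roots v_i - v_j for i < j.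
   Strong compatibility then means: if v_i - v_j is in Psi and i < k < j, then v_i - v_k or
   v_k - v_j is in Psi.

   For a point x of the upper closure of an alcove A and y in A, order each class of indices whose
   coordinates at x are congruent modulo 1 by the coordinates of y - x. Neighbours in this order
   give walls of A through x, hence ceilings, and splitting v_i - v_j along the order leads to a
   ceiling in Psi. Conversely, given i < k < j, there are an alcove
   and a point x of its upper closure at which v_i - v_j takes the value 2 and through which only
   the ceilings belonging to v_i - v_k and v_k - v_j pass. *)
theory Submission
  imports Defs
begin

section \<open>Alcoves and their walls\<close>

text \<open>The roots that are integral at \<open>x\<close> are the differences within the classes,
  so near \<open>x\<close> the alcove looks like a chamber of a product of smaller type A systems.
  This is why its walls there come from neighbours. They are ceilings because the upper closure
  omits all points of other walls. Positive roots are positive on the parallelepiped, so a ceiling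
  has \<open>A\<close> below it. Every pair of neighbours therefore increases in index, and the
  order of a whole class is the index order; only then does splitting apply along it. The ceiling
  found at one point must contain the whole intersection with the hyperplane of v_i - v_j. It does,
  since v_i - v_j decomposes along the order into terms that are each maximal at \<open>x\<close> on
  the closure. In the converse, 2 = 1 + 1: the hyperplane at level 2 meets the closure only where
  both summands equal 1, in codimension 2, so it is no wall. The base witnessing type A need not be
  \<open>\<Delta>\<close>; the v_i are therefore sorted by the height with respect to
  \<open>\<Delta>\<close>.\<close>

lemma alcove_disjoint_hyperplane:
  assumes "A \<in> alcoves R" "y \<in> A" "\<alpha> \<in> R"
  shows "\<alpha> \<bullet> y \<noteq> of_int m"
proof -
  have "A \<subseteq> UNIV - (\<Union>\<alpha>\<in>R. \<Union>m. root_hyperplane \<alpha> m)"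
    using assms(1) in_components_subset unfolding alcoves_def by blast
  then show ?thesis using assms(2,3) by (auto simp: root_hyperplane_def)
qed

text \<open>By the intermediate value theorem a root that crosses \<open>m\<close> on the connected
  set \<open>A\<close> would attain \<open>m\<close> there. One point \<open>y\<close> thus fixes
  the side of every root hyperplane for all of \<open>A\<close>.\<close>

lemma alcove_strip:
  assumes A: "A \<in> alcoves R" and "y \<in> A" "z \<in> A" "\<alpha> \<in> R"
  shows "\<alpha> \<bullet> z < of_int m \<longleftrightarrow> \<alpha> \<bullet> y < of_int m"
proof (rule ccontr)
  assume *: "\<not> ?thesis"
  have c: "connected A" using A in_components_connected unfolding alcoves_def by blast
  have "\<exists>w\<in>A. \<alpha> \<bullet> w = of_int m"
    using * connected_ivt_hyperplane[OF c \<open>y \<in> A\<close> \<open>z \<in> A\<close>, of \<alpha> "of_int m"]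
      connected_ivt_hyperplane[OF c \<open>z \<in> A\<close> \<open>y \<in> A\<close>, of \<alpha> "of_int m"] by linarith
  then show False using alcove_disjoint_hyperplane[OF A] \<open>\<alpha> \<in> R\<close> by blast
qed

text \<open>The cell on the right is convex, hence connected, and misses every hyperplane, so
  maximality of components puts it inside \<open>A\<close>. This replaces the topological definition
  of an alcove by inequalities.\<close>

lemma alcove_eq:
  assumes A: "A \<in> alcoves R" and y: "y \<in> A"
  shows "A = {z. \<forall>\<alpha>\<in>R. of_int \<lfloor>\<alpha> \<bullet> y\<rfloor> < \<alpha> \<bullet> z \<and> \<alpha> \<bullet> z < of_int \<lfloor>\<alpha> \<bullet> y\<rfloor> + 1}" (is "A = ?C")
proof
  have strict: "of_int \<lfloor>\<alpha> \<bullet> y\<rfloor> < \<alpha> \<bullet> y" if "\<alpha> \<in> R" for \<alpha>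
    using alcove_disjoint_hyperplane[OF A y that, of "\<lfloor>\<alpha> \<bullet> y\<rfloor>"] by linarith
  show "A \<subseteq> ?C"
  proof (intro subsetI CollectI ballI)
    fix z \<alpha> assume z: "z \<in> A" and \<alpha>: "\<alpha> \<in> R"
    show "of_int \<lfloor>\<alpha> \<bullet> y\<rfloor> < \<alpha> \<bullet> z \<and> \<alpha> \<bullet> z < of_int \<lfloor>\<alpha> \<bullet> y\<rfloor> + 1"
      using alcove_strip[OF A y z \<alpha>, of "\<lfloor>\<alpha> \<bullet> y\<rfloor>"] alcove_strip[OF A y z \<alpha>, of "\<lfloor>\<alpha> \<bullet> y\<rfloor> + 1"]
        strict[OF \<alpha>] alcove_disjoint_hyperplane[OF A z \<alpha>, of "\<lfloor>\<alpha> \<bullet> y\<rfloor>"]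
      by (simp add: not_less)
  qed
  have "?C = (\<Inter>\<alpha>\<in>R. {z. \<alpha> \<bullet> z > of_int \<lfloor>\<alpha> \<bullet> y\<rfloor>} \<inter> {z. \<alpha> \<bullet> z < of_int \<lfloor>\<alpha> \<bullet> y\<rfloor> + 1})"
    by auto
  then have "convex ?C"
    by (simp only:) (intro convex_INT convex_Int convex_halfspace_gt convex_halfspace_lt)
  then have "connected ?C" by (rule convex_connected)
  moreover have "\<alpha> \<bullet> z \<noteq> of_int m" if "z \<in> ?C" "\<alpha> \<in> R" for z \<alpha> m
  proof
    assume "\<alpha> \<bullet> z = of_int m"
    moreover have "of_int \<lfloor>\<alpha> \<bullet> y\<rfloor> < \<alpha> \<bullet> z" "\<alpha> \<bullet> z < of_int (\<lfloor>\<alpha> \<bullet> y\<rfloor> + 1)" using that by auto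
    ultimately have "\<lfloor>\<alpha> \<bullet> y\<rfloor> < m" "m < \<lfloor>\<alpha> \<bullet> y\<rfloor> + 1" by (simp_all only: of_int_less_iff)
    then show False by linarith
  qed
  then have "?C \<subseteq> UNIV - (\<Union>\<alpha>\<in>R. \<Union>m. root_hyperplane \<alpha> m)"
    unfolding root_hyperplane_def by (intro subsetI) simp
  moreover have "y \<in> ?C" using strict by auto
  with y have "\<exists>w. w \<in> A \<inter> ?C" by (intro exI IntI)
  then have "A \<inter> ?C \<noteq> {}" by (simp only: ex_in_conv not_False_eq_True)
  ultimately show "?C \<subseteq> A"
    by (intro components_maximal[OF A[unfolded alcoves_def]])
qed

lemma alcove_exists:
  assumes "\<And>\<alpha>. \<alpha> \<in> R \<Longrightarrow> \<alpha> \<bullet> y \<notin> \<int>"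
  obtains A where "A \<in> alcoves R" "y \<in> A"
proof -
  let ?U = "UNIV - (\<Union>\<alpha>\<in>R. \<Union>m. root_hyperplane \<alpha> m)"
  have "y \<in> ?U" using assms by (force simp: root_hyperplane_def)
  then show thesis
    using that[of "connected_component_set ?U y"] componentsI[of y ?U]
    unfolding alcoves_def by (simp add: connected_component_refl)
qed

lemma alcove_open_convex:
  fixes A R :: "'a::euclidean_space set"
  assumes A: "A \<in> alcoves R" and R: "finite R"
  shows "open A" "convex A" "A \<noteq> {}"
proof -
  show "A \<noteq> {}" using A in_components_nonempty unfolding alcoves_def by blast
  then obtain y where "y \<in> A" by blast
  note eq = alcove_eq[OF A this]
  have "A = (\<Inter>\<alpha>\<in>R. {z. \<alpha> \<bullet> z > of_int \<lfloor>\<alpha> \<bullet> y\<rfloor>} \<inter> {z. \<alpha> \<bullet> z < of_int \<lfloor>\<alpha> \<bullet> y\<rfloor> + 1})"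
    by (subst eq) auto
  moreover have "open \<dots>"
    using R by (intro open_INT open_Int ballI open_halfspace_gt open_halfspace_lt)
  moreover have "convex \<dots>"
    by (intro convex_INT convex_Int convex_halfspace_gt convex_halfspace_lt)
  ultimately show "open A" "convex A" by simp_all
qed

text \<open>For the harder inclusion, weak bounds at \<open>z\<close> and strict bounds at
  \<open>y\<close> average to strict ones. The segment from \<open>z\<close> to \<open>y\<close>
  without \<open>z\<close> therefore lies in \<open>A\<close>, and \<open>z\<close> is a limit of
  it.\<close>

lemma closure_alcove:
  fixes A R :: "'a::euclidean_space set"
  assumes A: "A \<in> alcoves R" and y: "y \<in> A"
  shows "closure A = {z. \<forall>\<alpha>\<in>R. of_int \<lfloor>\<alpha> \<bullet> y\<rfloor> \<le> \<alpha> \<bullet> z \<and> \<alpha> \<bullet> z \<le> of_int \<lfloor>\<alpha> \<bullet> y\<rfloor> + 1}" (is "_ = ?C")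
proof
  have "?C = (\<Inter>\<alpha>\<in>R. {z. \<alpha> \<bullet> z \<ge> of_int \<lfloor>\<alpha> \<bullet> y\<rfloor>} \<inter> {z. \<alpha> \<bullet> z \<le> of_int \<lfloor>\<alpha> \<bullet> y\<rfloor> + 1})"
    by auto
  then have "closed ?C"
    by (simp only:) (intro closed_INT closed_Int ballI closed_halfspace_ge closed_halfspace_le)
  moreover have "A \<subseteq> ?C" by (subst alcove_eq[OF A y]) (auto intro: less_imp_le)
  ultimately show "closure A \<subseteq> ?C" by (simp add: closure_minimal)
  show "?C \<subseteq> closure A"
  proof
    fix z assume z: "z \<in> ?C"
    have seg: "z + t *\<^sub>R (y - z) \<in> A" if t: "0 < t" "t \<le> 1" for t
    proof (subst alcove_eq[OF A y], intro CollectI ballI)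
      fix \<alpha> assume \<alpha>: "\<alpha> \<in> R"
      let ?k = "of_int \<lfloor>\<alpha> \<bullet> y\<rfloor> :: real"
      have y': "?k < \<alpha> \<bullet> y" "\<alpha> \<bullet> y < ?k + 1"
        using alcove_disjoint_hyperplane[OF A y \<alpha>, of "\<lfloor>\<alpha> \<bullet> y\<rfloor>"] by linarith+
      have z': "?k \<le> \<alpha> \<bullet> z" "\<alpha> \<bullet> z \<le> ?k + 1" using z \<alpha> by auto
      have eq: "\<alpha> \<bullet> (z + t *\<^sub>R (y - z)) = (1 - t) * (\<alpha> \<bullet> z) + t * (\<alpha> \<bullet> y)"
        by (simp add: inner_diff_right inner_add_right algebra_simps)
      have "(1 - t) * ?k \<le> (1 - t) * (\<alpha> \<bullet> z)" "(1 - t) * (\<alpha> \<bullet> z) \<le> (1 - t) * (?k + 1)"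
        using z' t by (auto intro: mult_left_mono)
      moreover have "t * ?k < t * (\<alpha> \<bullet> y)" "t * (\<alpha> \<bullet> y) < t * (?k + 1)"
        using y' t by simp_all
      ultimately show "?k < \<alpha> \<bullet> (z + t *\<^sub>R (y - z)) \<and> \<alpha> \<bullet> (z + t *\<^sub>R (y - z)) < ?k + 1"
        unfolding eq by (simp add: algebra_simps)
    qed
    have "((\<lambda>t. z + t *\<^sub>R (y - z)) \<longlongrightarrow> z + 0 *\<^sub>R (y - z)) (at_right 0)"
      by (intro tendsto_intros)
    moreover have "\<forall>\<^sub>F t in at_right 0. z + t *\<^sub>R (y - z) \<in> closure A"
      unfolding eventually_at_right_field
      using seg closure_subset[of A] by (intro exI[of _ 1]) auto
    ultimately have "z + 0 *\<^sub>R (y - z) \<in> closure A"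
      by (intro Lim_in_closed_set[OF closed_closure]) auto
    then show "z \<in> closure A" by simp
  qed
qed

text \<open>An integer \<open>n\<close> that bounds \<open>y\<close> strictly in this way must be
  the floor, so the strip may be named by any integer at hand.\<close>

lemma closure_alcove_memI:
  fixes A R :: "'a::euclidean_space set"
  assumes A: "A \<in> alcoves R" and y: "y \<in> A"
    and "\<And>\<alpha>. \<alpha> \<in> R \<Longrightarrow> \<exists>n::int. of_int n < \<alpha> \<bullet> y \<and> \<alpha> \<bullet> y < of_int n + 1 \<and>
      of_int n \<le> \<alpha> \<bullet> z \<and> \<alpha> \<bullet> z \<le> of_int n + 1"
  shows "z \<in> closure A"
proof (subst closure_alcove[OF A y], intro CollectI ballI)
  fix \<alpha> assume "\<alpha> \<in> R"
  then obtain n :: int where n: "of_int n < \<alpha> \<bullet> y" "\<alpha> \<bullet> y < of_int n + 1"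
      "of_int n \<le> \<alpha> \<bullet> z" "\<alpha> \<bullet> z \<le> of_int n + 1" using assms(3) by blast
  then have "\<lfloor>\<alpha> \<bullet> y\<rfloor> = n" by linarith
  then show "of_int \<lfloor>\<alpha> \<bullet> y\<rfloor> \<le> \<alpha> \<bullet> z \<and> \<alpha> \<bullet> z \<le> of_int \<lfloor>\<alpha> \<bullet> y\<rfloor> + 1" using n by simp
qed

lemma closure_alcove_le:
  fixes A R :: "'a::euclidean_space set"
  assumes A: "A \<in> alcoves R" and y: "y \<in> A" and z: "z \<in> closure A" and \<alpha>: "\<alpha> \<in> R"
  shows "\<alpha> \<bullet> y < of_int m \<Longrightarrow> \<alpha> \<bullet> z \<le> of_int m" "of_int m < \<alpha> \<bullet> y \<Longrightarrow> of_int m \<le> \<alpha> \<bullet> z"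
proof -
  have *: "of_int \<lfloor>\<alpha> \<bullet> y\<rfloor> \<le> \<alpha> \<bullet> z" "\<alpha> \<bullet> z \<le> of_int \<lfloor>\<alpha> \<bullet> y\<rfloor> + 1"
    using z \<alpha> unfolding closure_alcove[OF A y] by auto
  show "\<alpha> \<bullet> z \<le> of_int m" if "\<alpha> \<bullet> y < of_int m"
  proof -
    from that have "\<lfloor>\<alpha> \<bullet> y\<rfloor> + 1 \<le> m" by linarith
    then have "real_of_int (\<lfloor>\<alpha> \<bullet> y\<rfloor> + 1) \<le> of_int m" by (simp only: of_int_le_iff)
    with * show ?thesis by simp
  qed
  show "of_int m \<le> \<alpha> \<bullet> z" if "of_int m < \<alpha> \<bullet> y"
  proof -
    from that have "m \<le> \<lfloor>\<alpha> \<bullet> y\<rfloor>" by linarith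
    then have "real_of_int m \<le> of_int \<lfloor>\<alpha> \<bullet> y\<rfloor>" by (simp only: of_int_le_iff)
    with * show ?thesis by simp
  qed
qed

lemma polyhedron_closure_alcove:
  fixes A R :: "'a::euclidean_space set"
  assumes A: "A \<in> alcoves R" and R: "finite R"
  shows "polyhedron (closure A)"
proof -
  obtain y where y: "y \<in> A" using alcove_open_convex(3)[OF assms] by blast
  have "closure A = \<Inter>((\<lambda>\<alpha>. {z. \<alpha> \<bullet> z \<ge> of_int \<lfloor>\<alpha> \<bullet> y\<rfloor>} \<inter> {z. \<alpha> \<bullet> z \<le> of_int \<lfloor>\<alpha> \<bullet> y\<rfloor> + 1}) ` R)"
    unfolding closure_alcove[OF A y] by auto
  then show ?thesis
    using R by (simp only:) (intro polyhedron_Inter finite_imageI,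
      auto intro: polyhedron_halfspace_ge polyhedron_halfspace_le)
qed

text \<open>A relative interior point \<open>z\<close> of the facet \<open>F\<close> lies outside
  \<open>A\<close>, so some root attains an end of its strip at \<open>z\<close>. That root
  hyperplane cuts out a face of the closure which meets the relative interior of \<open>F\<close>
  and hence contains \<open>F\<close>; comparing dimensions gives equality.\<close>

lemma wall_is_root_hyperplane:
  fixes A R :: "'a::euclidean_space set"
  assumes A: "A \<in> alcoves R" and R: "finite R" "0 \<notin> R" and H: "H \<in> walls A"
  shows "\<exists>\<alpha>\<in>R. \<exists>m. H = root_hyperplane \<alpha> m"
proof -
  note oc = alcove_open_convex[OF A R(1)]
  obtain F where F: "F facet_of closure A" "H = affine hull F"
    using H unfolding walls_def by blast
  have int: "interior (closure A) \<noteq> {}"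
    using oc interior_maximal[OF closure_subset, of A] by blast
  then have dim: "aff_dim (closure A) = DIM('a)" by (rule aff_dim_nonempty_interior)
  have face: "F face_of closure A" and Fne: "F \<noteq> {}" and aF: "aff_dim F = DIM('a) - 1"
    using F(1) dim unfolding facet_of_def by auto
  have "F \<noteq> closure A" using aF dim by auto
  then have "F \<inter> interior (closure A) = {}" by (rule face_of_disjoint_interior[OF face])
  then have disj: "F \<inter> A = {}"
    using oc interior_maximal[OF closure_subset, of A] by blast
  have "rel_interior F \<noteq> {}"
    using face_of_imp_convex[OF face] Fne rel_interior_eq_empty by blast
  then obtain z where z: "z \<in> rel_interior F" by blast
  then have zF: "z \<in> F" using rel_interior_subset by blast
  have zc: "z \<in> closure A" using zF face_of_imp_subset[OF face] by blast
  obtain y where y: "y \<in> A" using oc by blast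
  from zF disj have "z \<notin> A" by blast
  then obtain \<alpha> where \<alpha>: "\<alpha> \<in> R"
    and "\<not> (of_int \<lfloor>\<alpha> \<bullet> y\<rfloor> < \<alpha> \<bullet> z \<and> \<alpha> \<bullet> z < of_int \<lfloor>\<alpha> \<bullet> y\<rfloor> + 1)"
    using alcove_eq[OF A y] by blast
  moreover have "of_int \<lfloor>\<alpha> \<bullet> y\<rfloor> \<le> \<alpha> \<bullet> z \<and> \<alpha> \<bullet> z \<le> of_int \<lfloor>\<alpha> \<bullet> y\<rfloor> + 1"
    using zc \<alpha> unfolding closure_alcove[OF A y] by blast
  ultimately have cases: "\<alpha> \<bullet> z = of_int \<lfloor>\<alpha> \<bullet> y\<rfloor> \<or> \<alpha> \<bullet> z = of_int (\<lfloor>\<alpha> \<bullet> y\<rfloor> + 1)" by auto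
  obtain m where m: "closure A \<inter> {x. \<alpha> \<bullet> x = of_int m} face_of closure A" "\<alpha> \<bullet> z = of_int m"
  proof -
    have cc: "convex (closure A)" using oc(2) by (rule convex_closure)
    have cl: "of_int \<lfloor>\<alpha> \<bullet> y\<rfloor> \<le> \<alpha> \<bullet> w \<and> \<alpha> \<bullet> w \<le> of_int \<lfloor>\<alpha> \<bullet> y\<rfloor> + 1" if "w \<in> closure A" for w
      using that \<alpha> unfolding closure_alcove[OF A y] by blast
    have "closure A \<inter> {x. \<alpha> \<bullet> x = of_int \<lfloor>\<alpha> \<bullet> y\<rfloor>} face_of closure A"
      by (rule face_of_Int_supporting_hyperplane_ge) (use cc cl in auto)
    moreover have "closure A \<inter> {x. \<alpha> \<bullet> x = of_int (\<lfloor>\<alpha> \<bullet> y\<rfloor> + 1)} face_of closure A"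
      by (rule face_of_Int_supporting_hyperplane_le) (use cc cl in auto)
    ultimately show thesis using cases that by blast
  qed
  have "F \<subseteq> closure A \<inter> {x. \<alpha> \<bullet> x = of_int m}"
    using subset_of_face_of[OF m(1) face_of_imp_subset[OF face]] z zc m(2) by blast
  then have sub: "H \<subseteq> root_hyperplane \<alpha> m"
    unfolding F(2) root_hyperplane_def by (intro hull_minimal) (auto simp: affine_hyperplane)
  have "\<alpha> \<noteq> 0" using \<alpha> R by auto
  then have "H = root_hyperplane \<alpha> m"
    using sub aF Fne unfolding F(2) root_hyperplane_def
    by (intro affine_dim_equal) (auto simp: affine_hyperplane aff_dim_hyperplane)
  then show ?thesis using \<alpha> by blast
qed

text \<open>As \<open>A\<close> is open and convex, the points of the closure outside
  \<open>A\<close> form the relative frontier, which for a polyhedron is the union of its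
  facets.\<close>

lemma frontier_point_on_wall:
  fixes A R :: "'a::euclidean_space set"
  assumes A: "A \<in> alcoves R" and R: "finite R" and z: "z \<in> closure A" "z \<notin> A"
  obtains H where "H \<in> walls A" "z \<in> H"
proof -
  note oc = alcove_open_convex[OF A R(1)]
  have "rel_interior (closure A) = A"
    using oc by (simp add: convex_rel_interior_closure rel_interior_open)
  then have "z \<in> rel_frontier (closure A)" using z by (simp add: rel_frontier_def)
  then obtain F where "F facet_of closure A" "z \<in> F"
    using rel_frontier_of_polyhedron[OF polyhedron_closure_alcove[OF A R]] by blast
  then have "affine hull F \<in> walls A" "z \<in> affine hull F"
    unfolding walls_def by (auto intro: hull_inc)
  then show thesis by (rule that)
qed

lemma upper_closure_subset_closure: "upper_closure A \<subseteq> closure A"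
  using closure_subset unfolding upper_closure_def by blast

text \<open>Move from \<open>x\<close> a little in direction \<open>u\<close>. The hypotheses keep
  the point in the closure but on the hyperplane of \<open>\<alpha>0\<close>, hence outside
  \<open>A\<close>, so it lies on a wall. A short move meets no new root hyperplane, so this wall
  already passes through \<open>x\<close> and is parallel to \<open>u\<close>. A \<open>u\<close>
  orthogonal to few roots thus identifies the wall.\<close>

lemma wall_through_frontier_point:
  fixes A R :: "'a::euclidean_space set"
  assumes A: "A \<in> alcoves R" and R: "finite R" "0 \<notin> R"
    and y: "y \<in> A" and x: "x \<in> closure A"
    and u: "\<And>\<alpha>. \<alpha> \<in> R \<Longrightarrow> \<alpha> \<bullet> x \<in> \<int> \<Longrightarrow>
      (\<alpha> \<bullet> x < \<alpha> \<bullet> y \<longrightarrow> 0 \<le> \<alpha> \<bullet> u) \<and> (\<alpha> \<bullet> y < \<alpha> \<bullet> x \<longrightarrow> \<alpha> \<bullet> u \<le> 0)"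
    and ex: "\<alpha>0 \<in> R" "\<alpha>0 \<bullet> x \<in> \<int>" "\<alpha>0 \<bullet> u = 0"
  obtains \<beta> m where "\<beta> \<in> R" "root_hyperplane \<beta> m \<in> walls A" "\<beta> \<bullet> x = of_int m" "\<beta> \<bullet> u = 0"
proof -
  \<comment> \<open>First conjunct: the moved point shares a closed unit strip with
    \<open>y\<close>. Second conjunct: it meets no root hyperplane except one through
    \<open>x\<close> and parallel to \<open>u\<close>.\<close>
  define Q where "Q \<alpha> t \<longleftrightarrow> (\<exists>n::int. of_int n < \<alpha> \<bullet> y \<and> \<alpha> \<bullet> y < of_int n + 1 \<and>
      of_int n \<le> \<alpha> \<bullet> (x + t *\<^sub>R u) \<and> \<alpha> \<bullet> (x + t *\<^sub>R u) \<le> of_int n + 1) \<and>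
      (\<alpha> \<bullet> (x + t *\<^sub>R u) \<in> \<int> \<longrightarrow> \<alpha> \<bullet> x \<in> \<int> \<and> \<alpha> \<bullet> u = 0)" for \<alpha> t
  have evQ: "\<forall>\<^sub>F t in at_right 0. Q \<alpha> t" if \<alpha>: "\<alpha> \<in> R" for \<alpha>
  proof -
    let ?k = "\<lfloor>\<alpha> \<bullet> y\<rfloor>"
    have yk: "of_int ?k < \<alpha> \<bullet> y" "\<alpha> \<bullet> y < of_int ?k + 1"
      using alcove_disjoint_hyperplane[OF A y \<alpha>, of ?k] by linarith+
    have xk: "of_int ?k \<le> \<alpha> \<bullet> x" "\<alpha> \<bullet> x \<le> of_int ?k + 1"
      using closure_alcove_le[OF A y x \<alpha>, of ?k] closure_alcove_le[OF A y x \<alpha>, of "?k + 1"] yk by auto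
    have lim: "((\<lambda>t. \<alpha> \<bullet> (x + t *\<^sub>R u)) \<longlongrightarrow> \<alpha> \<bullet> (x + 0 *\<^sub>R u)) (at_right 0)"
      by (intro tendsto_intros)
    then have near: "\<forall>\<^sub>F t in at_right 0. a < \<alpha> \<bullet> (x + t *\<^sub>R u) \<and> \<alpha> \<bullet> (x + t *\<^sub>R u) < b"
      if "a < \<alpha> \<bullet> x" "\<alpha> \<bullet> x < b" for a b
      using that by (intro eventually_conj order_tendstoD[OF lim]) auto
    have no_int: "w \<notin> \<int>" if "of_int n < w" "w < of_int n + 1" for w :: real and n :: int
    proof
      assume "w \<in> \<int>"
      then obtain m :: int where "w = of_int m" by (auto elim: Ints_cases)
      then have "of_int n < (of_int m :: real)" "of_int m < (of_int (n + 1) :: real)" using that by auto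
      then have "n < m" "m < n + 1" by (simp_all only: of_int_less_iff)
      then show False by linarith
    qed
    \<comment> \<open>A root not integral at \<open>x\<close> stays strictly inside its strip for
      small \<open>t\<close>. One with integral value \<open>N\<close> stays within distance less
      than 1 of \<open>N\<close>, and the sign of \<open>\<alpha> \<bullet> u\<close> keeps it on
      the side of \<open>y\<close>.\<close>
    show ?thesis
    proof (cases "\<alpha> \<bullet> x \<in> \<int>")
      case False
      then have "\<alpha> \<bullet> x \<noteq> of_int ?k" "\<alpha> \<bullet> x \<noteq> of_int (?k + 1)" by (metis Ints_of_int)+
      then have "of_int ?k < \<alpha> \<bullet> x" "\<alpha> \<bullet> x < of_int ?k + 1" using xk by auto
      from near[OF this] show ?thesis
      proof eventually_elim
        case (elim t)
        then show ?case unfolding Q_def using yk no_int[of ?k "\<alpha> \<bullet> (x + t *\<^sub>R u)"]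
          by (intro conjI exI[of _ ?k]) auto
      qed
    next
      case True
      then obtain N :: int where N: "\<alpha> \<bullet> x = of_int N" by (auto elim: Ints_cases)
      have kN: "?k \<le> N" "N \<le> ?k + 1"
      proof -
        have "of_int ?k \<le> (of_int N :: real)" "of_int N \<le> (of_int (?k + 1) :: real)"
          using xk unfolding N by auto
        then show "?k \<le> N" "N \<le> ?k + 1" by (simp_all only: of_int_le_iff)
      qed
      have "\<forall>\<^sub>F t in at_right 0. of_int N - 1 < \<alpha> \<bullet> (x + t *\<^sub>R u) \<and> \<alpha> \<bullet> (x + t *\<^sub>R u) < of_int N + 1"
        by (rule near) (auto simp: N)
      moreover have "\<forall>\<^sub>F t in at_right (0::real). 0 < t" by (simp add: eventually_at_right_less)
      ultimately show ?thesis
      proof eventually_elim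
        case (elim t)
        let ?w = "\<alpha> \<bullet> (x + t *\<^sub>R u)"
        have w: "?w = of_int N + t * (\<alpha> \<bullet> u)" by (simp add: inner_add_right N)
        have "?w \<in> \<int> \<Longrightarrow> ?w = of_int N"
          using no_int[of "N - 1" ?w] no_int[of N ?w] elim by fastforce
        then have int: "?w \<in> \<int> \<longrightarrow> \<alpha> \<bullet> x \<in> \<int> \<and> \<alpha> \<bullet> u = 0" using w elim True by auto
        consider "N = ?k" | "N = ?k + 1" using kN by linarith
        then show ?case
        proof cases
          case 1
          then have "0 \<le> \<alpha> \<bullet> u" using u[OF \<alpha> True] yk N by auto
          then have "of_int N \<le> ?w" unfolding w using elim by simp
          then show ?thesis unfolding Q_def using int yk elim 1 by (intro conjI exI[of _ ?k]) auto
        next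
          case 2
          then have "of_int N = (of_int ?k :: real) + 1" by simp
          then have "\<alpha> \<bullet> u \<le> 0" using u[OF \<alpha> True] yk N by auto
          then have "?w \<le> of_int N" unfolding w using elim by (simp add: mult_nonneg_nonpos)
          then show ?thesis unfolding Q_def using int yk elim \<open>of_int N = (of_int ?k :: real) + 1\<close>
            by (intro conjI exI[of _ ?k]) auto
        qed
      qed
    qed
  qed
  have "\<forall>\<^sub>F t in at_right 0. \<forall>\<alpha>\<in>R. Q \<alpha> t" using evQ R(1) by (simp add: eventually_ball_finite)
  then have "\<exists>t. \<forall>\<alpha>\<in>R. Q \<alpha> t" by (rule eventually_happens'[OF trivial_limit_at_right_real])
  then obtain t where t: "\<forall>\<alpha>\<in>R. Q \<alpha> t" by (rule exE)
  let ?z = "x + t *\<^sub>R u"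
  have "?z \<in> closure A"
    by (rule closure_alcove_memI[OF A y]) (use t[unfolded Q_def] in simp)
  moreover have "?z \<notin> A"
  proof
    assume "?z \<in> A"
    moreover obtain m :: int where "\<alpha>0 \<bullet> x = of_int m" using ex(2) by (auto elim: Ints_cases)
    then have "\<alpha>0 \<bullet> ?z = of_int m" using ex(3) by (simp add: inner_add_right)
    ultimately show False using alcove_disjoint_hyperplane[OF A _ ex(1)] by blast
  qed
  ultimately obtain H where H: "H \<in> walls A" "?z \<in> H"
    using frontier_point_on_wall[OF A R(1)] by metis
  then obtain \<beta> m where \<beta>: "\<beta> \<in> R" "H = root_hyperplane \<beta> m"
    using wall_is_root_hyperplane[OF A R] by blast
  then have z: "\<beta> \<bullet> ?z = of_int m" using H(2) by (simp add: root_hyperplane_def)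
  then have "\<beta> \<bullet> u = 0" using t \<beta>(1) unfolding Q_def by (metis Ints_of_int)
  moreover from this have "\<beta> \<bullet> x = of_int m" using z by (simp add: inner_add_right)
  ultimately show thesis using that \<beta> H(1) by blast
qed

text \<open>The definition of a ceiling provides some normal \<open>a\<close>, not
  \<open>\<beta>\<close>, so the side is recovered through the origin. If \<open>y\<close> lay
  beyond level \<open>m\<close>, a point \<open>s *\<^sub>R y\<close> with \<open>0 < s < 1\<close>
  would lie on the hyperplane, giving \<open>s * (a \<bullet> y) = b\<close>, against
  \<open>a \<bullet> y < b\<close> and \<open>0 < b\<close>.\<close>

lemma ceiling_side:
  fixes A R :: "'a::euclidean_space set"
  assumes A: "A \<in> alcoves R" and y: "y \<in> A" and \<beta>: "\<beta> \<in> R"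
    and H: "root_hyperplane \<beta> m \<in> ceilings A" and "0 \<le> m"
  shows "0 < m" "\<beta> \<bullet> y < of_int m"
proof -
  obtain a b where ab: "root_hyperplane \<beta> m = {x. a \<bullet> x = b}" "0 < b" "\<forall>x\<in>A. a \<bullet> x < b"
    using H unfolding ceilings_def by blast
  have "0 \<notin> root_hyperplane \<beta> m" unfolding ab(1) using ab(2) by simp
  then show m: "0 < m" using \<open>0 \<le> m\<close> by (auto simp: root_hyperplane_def order_le_less)
  show "\<beta> \<bullet> y < of_int m"
  proof (rule ccontr)
    assume "\<not> ?thesis"
    then have gt: "of_int m < \<beta> \<bullet> y" using alcove_disjoint_hyperplane[OF A y \<beta>, of m] by linarith
    define s where "s = of_int m / (\<beta> \<bullet> y)"
    have s: "0 < s" "s < 1" using m gt unfolding s_def by auto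
    have "s *\<^sub>R y \<in> root_hyperplane \<beta> m" using m gt by (simp add: root_hyperplane_def s_def)
    then have "s * (a \<bullet> y) = b" unfolding ab(1) by simp
    moreover have "s * (a \<bullet> y) < s * b" using ab(3) y s by simp
    ultimately show False using s ab(2) by (smt (verit) mult_le_cancel_right1)
  qed
qed

section \<open>Coordinates for type A\<close>

text \<open>The \<open>v i\<close> live in the space itself rather than in one of dimension
  \<open>l + 1\<close>, so only their differences carry meaning. The assumption
  \<open>coordinates\<close> is the dual form of the linear independence of the simple roots, and
  root lengths stay arbitrary.\<close>

locale type_A_coordinates =
  fixes v :: "nat \<Rightarrow> 'a::euclidean_space" and l :: nat and R \<Delta> :: "'a set"
  assumes roots: "R = {v i - v j | i j. i < j \<and> j \<le> l}"
    and simples: "\<Delta> = {v i - v (Suc i) | i. i < l}"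
    and coordinates: "\<And>f :: nat \<Rightarrow> real. \<exists>x. \<forall>i\<le>l. \<forall>j\<le>l. (v i - v j) \<bullet> x = f i - f j"
begin

lemma point_with_coordinates:
  fixes f :: "nat \<Rightarrow> real"
  obtains x where "\<And>i j. i \<le> l \<Longrightarrow> j \<le> l \<Longrightarrow> (v i - v j) \<bullet> x = f i - f j"
  using coordinates[of f] by blast

lemma rootI: "i < j \<Longrightarrow> j \<le> l \<Longrightarrow> v i - v j \<in> R"
  unfolding roots by blast

lemma rootE:
  assumes "\<alpha> \<in> R"
  obtains i j where "i < j" "j \<le> l" "\<alpha> = v i - v j"
  using assms unfolding roots by blast

lemma finite_roots: "finite R"
proof -
  have "R \<subseteq> (\<lambda>(i, j). v i - v j) ` ({..l} \<times> {..l})" unfolding roots by auto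
  then show ?thesis by (rule finite_subset) simp
qed

lemma zero_not_root: "0 \<notin> R"
proof
  assume "0 \<in> R"
  then obtain i j where ij: "i < j" "j \<le> l" "0 = v i - v j" by (rule rootE)
  obtain x where "\<And>a b. a \<le> l \<Longrightarrow> b \<le> l \<Longrightarrow> (v a - v b) \<bullet> x = real a - real b"
    using point_with_coordinates[of real] by blast
  from this[of i j] ij show False by simp
qed

section \<open>Strong compatibility as a splitting condition\<close>

definition splits :: "'a set \<Rightarrow> bool" where
  "splits \<Psi> \<longleftrightarrow> \<Psi> \<subseteq> R \<and>
     (\<forall>i k j. i < k \<and> k < j \<and> j \<le> l \<and> v i - v j \<in> \<Psi> \<longrightarrow> v i - v k \<in> \<Psi> \<or> v k - v j \<in> \<Psi>)"

lemma splits_if_strongly_compatible: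
  assumes S: "strongly_compatible R \<Psi>"
  shows "splits \<Psi>"
  unfolding splits_def
proof (intro conjI allI impI)
  show "\<Psi> \<subseteq> R" using S unfolding strongly_compatible_def by blast
  fix i k j assume *: "i < k \<and> k < j \<and> j \<le> l \<and> v i - v j \<in> \<Psi>"
  define \<beta> where "\<beta> n = (if n = (1::nat) then v i - v k else v k - v j)" for n
  have "\<exists>n\<in>{1..2}. \<beta> n \<in> \<Psi>"
  proof (rule S[unfolded strongly_compatible_def, THEN conjunct2, THEN bspec, THEN spec, THEN spec,
        THEN spec[of _ "\<lambda>_. 1"], THEN mp])
    show "v i - v j \<in> \<Psi>" using * by blast
    show "(\<forall>n\<in>{1..2}. \<beta> n \<in> R \<and> 0 < (1::nat)) \<and> v i - v j = (\<Sum>n = 1..2. of_nat 1 *\<^sub>R \<beta> n)"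
      using * rootI[of i k] rootI[of k j] by (auto simp: \<beta>_def numeral_2_eq_2)
  qed
  then show "v i - v k \<in> \<Psi> \<or> v k - v j \<in> \<Psi>" unfolding \<beta>_def by (auto split: if_splits)
qed

text \<open>If no \<open>\<beta>\<^sub>k\<close> lies in \<open>\<Psi>\<close>, then the indicator function of \<open>T\<close> below is a functional that is
  nonpositive on every \<open>\<beta>\<^sub>k\<close> and positive on their combination.\<close>

lemma strongly_compatible_if_splits:
  assumes S: "splits \<Psi>"
  shows "strongly_compatible R \<Psi>"
  unfolding strongly_compatible_def
proof (intro conjI ballI allI impI)
  show "\<Psi> \<subseteq> R" using S unfolding splits_def by blast
  fix \<alpha> and m :: nat and \<beta> :: "nat \<Rightarrow> 'a" and c :: "nat \<Rightarrow> nat"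
  assume \<alpha>: "\<alpha> \<in> \<Psi>"
    and sum: "(\<forall>i\<in>{1..m}. \<beta> i \<in> R \<and> 0 < c i) \<and> \<alpha> = (\<Sum>i = 1..m. of_nat (c i) *\<^sub>R \<beta> i)"
  show "\<exists>k\<in>{1..m}. \<beta> k \<in> \<Psi>"
  proof (rule ccontr)
    assume none: "\<not> ?thesis"
    have "\<alpha> \<in> R" using \<alpha> \<open>\<Psi> \<subseteq> R\<close> by blast
    then obtain i j where ij: "i < j" "j \<le> l" "\<alpha> = v i - v j" by (rule rootE)
    \<comment> \<open>\<open>T\<close> is closed under steps \<open>a < b\<close> with
      \<open>v a - v b\<close> outside \<open>\<Psi>\<close>: if \<open>v i - v b\<close> were in
      \<open>\<Psi>\<close>, splitting it at \<open>a\<close> would put one of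
      \<open>v i - v a\<close>, \<open>v a - v b\<close> into \<open>\<Psi>\<close>. It contains
      \<open>i\<close> but not \<open>j\<close>.\<close>
    define T where "T = {b. b = i \<or> i < b \<and> b \<le> l \<and> v i - v b \<notin> \<Psi>}"
    have T: "b \<in> T" if "a \<in> T" "a < b" "b \<le> l" "v a - v b \<notin> \<Psi>" for a b
      using that S unfolding T_def splits_def by auto
    obtain x where x: "\<And>a b. a \<le> l \<Longrightarrow> b \<le> l \<Longrightarrow> (v a - v b) \<bullet> x = of_bool (a \<in> T) - of_bool (b \<in> T)"
      using point_with_coordinates[of "\<lambda>a. of_bool (a \<in> T)"] by blast
    have "\<beta> n \<bullet> x \<le> 0" if n: "n \<in> {1..m}" for n
    proof -
      have "\<beta> n \<in> R" "\<beta> n \<notin> \<Psi>" using sum none n by auto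
      then obtain a b where ab: "a < b" "b \<le> l" "\<beta> n = v a - v b" by (auto elim: rootE)
      then show ?thesis using x[of a b] T[of a b] \<open>\<beta> n \<notin> \<Psi>\<close> by auto
    qed
    then have "(\<Sum>n = 1..m. of_nat (c n) *\<^sub>R \<beta> n) \<bullet> x \<le> 0"
      by (auto simp: inner_sum_left intro!: sum_nonpos mult_nonneg_nonpos)
    moreover have "\<alpha> \<bullet> x = 1"
      using x[of i j] ij \<alpha> by (auto simp: T_def)
    ultimately show False using sum by simp
  qed
qed

section \<open>From splitting to Worpitzky-compatibility\<close>

lemma root_pos_on_fundamental_parallelepiped:
  assumes z: "z \<in> fundamental_parallelepiped \<Delta>" and "i < j" "j \<le> l"
  shows "0 < (v i - v j) \<bullet> z"
  using \<open>i < j\<close> \<open>j \<le> l\<close>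
proof (induction j)
  case 0 then show ?case by simp
next
  case (Suc j)
  have "v j - v (Suc j) \<in> \<Delta>" using Suc.prems unfolding simples by auto
  then have "0 < (v j - v (Suc j)) \<bullet> z" using z unfolding fundamental_parallelepiped_def by blast
  moreover have "0 \<le> (v i - v j) \<bullet> z" using Suc by (cases "i = j") auto
  ultimately show ?case by (simp add: inner_diff_left)
qed

text \<open>Raising the coordinate \<open>k\<close> of \<open>y - x\<close> to the next larger one \<open>k'\<close> within the class of
  indices congruent to \<open>k\<close> at \<open>x\<close> yields a direction that stays in \<open>closure A\<close> near \<open>x\<close> and lies
  on no root hyperplane other than that of \<open>k\<close> and \<open>k'\<close>.\<close>

lemma ceiling_of_consecutive:
  assumes A: "A \<in> alcoves R" "A \<subseteq> fundamental_parallelepiped \<Delta>"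
    and y: "y \<in> A" and x: "x \<in> closure A"
    and ceil: "\<And>H. H \<in> walls A \<Longrightarrow> x \<in> H \<Longrightarrow> H \<in> ceilings A"
    and k: "k \<le> l" "k' \<le> l" "(v k - v k') \<bullet> x \<in> \<int>" "v k \<bullet> (y - x) < v k' \<bullet> (y - x)"
    and consec: "\<And>j. j \<le> l \<Longrightarrow> (v k - v j) \<bullet> x \<in> \<int> \<Longrightarrow>
      v j \<bullet> (y - x) \<le> v k \<bullet> (y - x) \<or> v k' \<bullet> (y - x) \<le> v j \<bullet> (y - x)"
  shows "k < k'"
    and "\<exists>m. root_hyperplane (v k - v k') m \<in> ceilings A \<and> (v k - v k') \<bullet> x = of_int m"
proof -
  define d where "d i = v i \<bullet> (y - x)" for i
  have d: "(v i - v j) \<bullet> y = (v i - v j) \<bullet> x + (d i - d j)" for i j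
    by (simp add: d_def inner_diff_left inner_diff_right)
  have Ints_sym: "(v i - v j) \<bullet> x \<in> \<int>" if "(v j - v i) \<bullet> x \<in> \<int>" for i j
    using Ints_minus[OF that] by (simp add: inner_diff_left)
  have inj': "d i \<noteq> d j" if "i < j" "j \<le> l" "(v i - v j) \<bullet> x \<in> \<int>" for i j
  proof
    assume "d i = d j"
    then have "(v i - v j) \<bullet> y \<in> \<int>" using d[of i j] that(3) by simp
    then show False using alcove_disjoint_hyperplane[OF A(1) y rootI[OF that(1,2)]]
      by (auto elim: Ints_cases)
  qed
  have inj: "i = j" if "i \<le> l" "j \<le> l" "(v i - v j) \<bullet> x \<in> \<int>" "d i = d j" for i j
    using inj'[of i j] inj'[of j i] Ints_sym[of j i] Ints_sym[of i j] that by (metis linorder_neqE_nat)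
  have dk: "d k < d k'" using k(4) unfolding d_def .
  have consec: "d j \<le> d k \<or> d k' \<le> d j" if "j \<le> l" "(v k - v j) \<bullet> x \<in> \<int>" for j
    using consec[OF that] unfolding d_def .
  obtain e where e: "\<And>i j. i \<le> l \<Longrightarrow> j \<le> l \<Longrightarrow> (v i - v j) \<bullet> e = of_bool (i = k) - of_bool (j = k)"
    using point_with_coordinates[of "\<lambda>i. of_bool (i = k)"] by blast
  define u where "u = (y - x) + (d k' - d k) *\<^sub>R e"
  have u: "(v i - v j) \<bullet> u = (if i = k then d k' else d i) - (if j = k then d k' else d j)"
    if "i \<le> l" "j \<le> l" for i j
  proof -
    have "(v i - v j) \<bullet> u = (d i - d j) + (d k' - d k) * (of_bool (i = k) - of_bool (j = k))"
      using e[OF that] unfolding u_def d_def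
      by (simp add: inner_add_right[of _ "y - x"] inner_diff_left[of _ _ "y - x"])
    then show ?thesis by (auto simp: algebra_simps)
  qed
  \<comment> \<open>Raising \<open>d k\<close> to \<open>d k'\<close> could reverse a pair only if
    some \<open>d j\<close> of the class lay strictly between the two, which \<open>consec\<close>
    excludes.\<close>
  have side: "(\<alpha> \<bullet> x < \<alpha> \<bullet> y \<longrightarrow> 0 \<le> \<alpha> \<bullet> u) \<and> (\<alpha> \<bullet> y < \<alpha> \<bullet> x \<longrightarrow> \<alpha> \<bullet> u \<le> 0)"
    if "\<alpha> \<in> R" "\<alpha> \<bullet> x \<in> \<int>" for \<alpha>
  proof -
    obtain i j where ij: "i < j" "j \<le> l" "\<alpha> = v i - v j" using \<open>\<alpha> \<in> R\<close> by (rule rootE)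
    have int: "(v i - v j) \<bullet> x \<in> \<int>" "(v j - v i) \<bullet> x \<in> \<int>"
      using that(2) ij(3) Ints_sym by auto
    show ?thesis
      using u[of i j] d[of i j] ij dk consec[of j] consec[of i] int by (cases "i = k"; cases "j = k") auto
  qed
  \<comment> \<open>Either sign has to be allowed: \<open>k < k'\<close> is a conclusion, obtained
    from the orientation of the wall found below.\<close>
  obtain \<alpha> where \<alpha>: "\<alpha> \<in> R" "\<alpha> = v k - v k' \<or> \<alpha> = v k' - v k"
    using dk k rootI[of k k'] rootI[of k' k] by (metis linorder_neqE_nat less_irrefl)
  have "\<alpha> \<bullet> x \<in> \<int>" "\<alpha> \<bullet> u = 0"
    using \<alpha>(2) k Ints_sym[OF k(3)] u[of k k'] u[of k' k] by auto
  then obtain \<beta> m where \<beta>: "\<beta> \<in> R" "root_hyperplane \<beta> m \<in> walls A" "\<beta> \<bullet> x = of_int m" "\<beta> \<bullet> u = 0"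
    using wall_through_frontier_point[OF A(1) finite_roots zero_not_root y x side \<alpha>(1)] by metis
  obtain a b where ab: "a < b" "b \<le> l" "\<beta> = v a - v b" using \<beta>(1) by (rule rootE)
  have H: "root_hyperplane \<beta> m \<in> ceilings A"
    using \<beta> by (intro ceil) (auto simp: root_hyperplane_def)
  have "0 < \<beta> \<bullet> y"
    using root_pos_on_fundamental_parallelepiped[of y a b] A(2) y ab by blast
  then have "0 \<le> \<beta> \<bullet> x" using closure_alcove_le(2)[OF A(1) y x \<beta>(1), of 0] by simp
  then have "0 \<le> m" using \<beta>(3) by simp
  then have "\<beta> \<bullet> y < \<beta> \<bullet> x" using ceiling_side(2)[OF A(1) y \<beta>(1) H] \<beta>(3) by simp
  then have dab: "d a < d b" using d[of a b] ab by simp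
  have int: "(v a - v b) \<bullet> x \<in> \<int>" using \<beta>(3) ab(3) by simp
  \<comment> \<open>\<open>\<beta> \<bullet> u = 0\<close> says that the raised coordinates of
    \<open>a\<close> and \<open>b\<close> agree. As \<open>d\<close> is injective on the class, this
    happens only for \<open>k\<close> and \<open>k'\<close>, and \<open>d a < d b\<close> settles
    which is which.\<close>
  have "a = k \<and> b = k'"
  proof (cases "a = k")
    case True
    then have "d b = d k'" using u[of a b] \<beta>(4) ab by simp
    moreover have "(v b - v k') \<bullet> x \<in> \<int>"
      using Ints_diff[OF k(3) int] True by (simp add: inner_diff_left)
    ultimately show ?thesis using inj[of b k'] ab k True by simp
  next
    case False
    then have *: "d a = (if b = k then d k' else d b)" using u[of a b] \<beta>(4) ab by simp
    then have "b = k" using dab by (auto split: if_splits)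
    then show ?thesis using * dk dab by simp
  qed
  then show "k < k'" "\<exists>m. root_hyperplane (v k - v k') m \<in> ceilings A \<and> (v k - v k') \<bullet> x = of_int m"
    using ab H \<beta>(3) by auto
qed

lemma worpitzky_compatible_if_splits:
  assumes S: "splits \<Psi>"
  shows "worpitzky_compatible R \<Delta> \<Psi>"
  unfolding worpitzky_compatible_def
proof (intro conjI ballI allI impI)
  show sub: "\<Psi> \<subseteq> R" using S unfolding splits_def by blast
  fix A \<alpha> m assume A: "A \<in> alcoves R" "A \<subseteq> fundamental_parallelepiped \<Delta>" and \<alpha>: "\<alpha> \<in> \<Psi>"
  let ?F = "upper_closure A \<inter> root_hyperplane \<alpha> m"
  have "\<exists>\<beta>\<in>\<Psi>. \<exists>m'. root_hyperplane \<beta> m' \<in> ceilings A \<and> ?F \<subseteq> root_hyperplane \<beta> m'" if "x \<in> ?F" for x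
  proof -
    have \<alpha>R: "\<alpha> \<in> R" using sub \<alpha> by blast
    have xm: "\<alpha> \<bullet> x = of_int m" using that by (simp add: root_hyperplane_def)
    have x: "x \<in> closure A" using that upper_closure_subset_closure by blast
    have "x \<notin> A" using alcove_disjoint_hyperplane[OF A(1) _ \<alpha>R] xm by blast
    then have ceil: "H \<in> ceilings A" if "H \<in> walls A" "x \<in> H" for H
      using \<open>x \<in> ?F\<close> that unfolding upper_closure_def by blast
    obtain y where y: "y \<in> A" using alcove_open_convex(3)[OF A(1) finite_roots] by blast
    define d where "d i = v i \<bullet> (y - x)" for i
    have d: "(v i - v j) \<bullet> y = (v i - v j) \<bullet> x + (d i - d j)" for i j
      by (simp add: d_def inner_diff_left inner_diff_right)
    obtain p q where pq: "p < q" "q \<le> l" "\<alpha> = v p - v q" using \<alpha>R by (rule rootE)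
    define C where "C = {j. j \<le> l \<and> (v p - v j) \<bullet> x \<in> \<int>}"
    have pC: "p \<in> C" and qC: "q \<in> C" using pq xm by (auto simp: C_def)
    have CI: "(v i - v j) \<bullet> x \<in> \<int>" if "i \<in> C" "j \<in> C" for i j
    proof -
      have "(v p - v j) \<bullet> x - (v p - v i) \<bullet> x \<in> \<int>" using that unfolding C_def by (intro Ints_diff) auto
      then show ?thesis by (simp add: inner_diff_left)
    qed
    have CI': "j \<in> C" if "i \<in> C" "j \<le> l" "(v i - v j) \<bullet> x \<in> \<int>" for i j
    proof -
      have "(v p - v i) \<bullet> x + (v i - v j) \<bullet> x \<in> \<int>" using that unfolding C_def by (intro Ints_add) auto
      then show ?thesis using that by (simp add: inner_diff_left C_def)
    qed
    have inj': "d i \<noteq> d j" if "i < j" "i \<in> C" "j \<in> C" for i j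
    proof
      assume "d i = d j"
      then have "(v i - v j) \<bullet> y \<in> \<int>" using d[of i j] CI[OF that(2,3)] by simp
      moreover have "v i - v j \<in> R" using that by (intro rootI) (auto simp: C_def)
      ultimately show False using alcove_disjoint_hyperplane[OF A(1) y] by (auto elim: Ints_cases)
    qed
    have inj: "i = j" if "i \<in> C" "j \<in> C" "d i = d j" for i j
      using inj'[of i j] inj'[of j i] that by (metis linorder_neqE_nat)
    \<comment> \<open>The indices of the class strictly between \<open>i\<close> and
      \<open>j\<close> in the order of \<open>d\<close>; their number is the measure of both
      inductions below.\<close>
    define B where "B i j = {k \<in> C. d i < d k \<and> d k < d j}" for i j
    have fin: "finite (B i j)" for i j
      by (rule finite_subset[of _ "{..l}"]) (auto simp: B_def C_def)
    have B: "card (B i k) < card (B i j)" "card (B k j) < card (B i j)" if "k \<in> B i j" for i j k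
    proof -
      have "B i k \<subset> B i j" "B k j \<subset> B i j" using that by (auto simp: B_def)
      then show "card (B i k) < card (B i j)" "card (B k j) < card (B i j)"
        by (auto intro: psubset_card_mono[OF fin])
    qed
    have consec: "k < k'" "\<exists>m. root_hyperplane (v k - v k') m \<in> ceilings A \<and> (v k - v k') \<bullet> x = of_int m"
      if "k \<in> C" "k' \<in> C" "d k < d k'" "B k k' = {}" for k k'
    proof -
      have *: "v j \<bullet> (y - x) \<le> v k \<bullet> (y - x) \<or> v k' \<bullet> (y - x) \<le> v j \<bullet> (y - x)"
        if "j \<le> l" "(v k - v j) \<bullet> x \<in> \<int>" for j
        using CI'[OF \<open>k \<in> C\<close> that] \<open>B k k' = {}\<close> unfolding B_def d_def by force
      have **: "k \<le> l" "k' \<le> l" "v k \<bullet> (y - x) < v k' \<bullet> (y - x)"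
        using that by (auto simp: C_def d_def)
      note ceiling_of_consecutive[OF A y x ceil **(1,2) CI[OF that(1,2)] **(3) *]
      then show "k < k'" "\<exists>m. root_hyperplane (v k - v k') m \<in> ceilings A \<and> (v k - v k') \<bullet> x = of_int m"
        by blast+
    qed
    \<comment> \<open>Neighbours satisfy \<open>k < k'\<close> because their wall is a ceiling;
      chaining neighbours carries this over to all pairs of the class.\<close>
    have mono: "i < j" if "i \<in> C" "j \<in> C" "d i < d j" for i j
      using that
    proof (induction "card (B i j)" arbitrary: i j rule: less_induct)
      case less
      show ?case
      proof (cases "B i j = {}")
        case True
        then show ?thesis using consec(1) less.prems by blast
      next
        case False
        then obtain k where k: "k \<in> B i j" by blast
        then have kC: "k \<in> C" "d i < d k" "d k < d j" by (auto simp: B_def)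
        have "i < k" by (rule less.hyps[OF B(1)[OF k] less.prems(1) kC(1,2)])
        also have "k < j" by (rule less.hyps[OF B(2)[OF k] kC(1) less.prems(2) kC(3)])
        finally show ?thesis .
      qed
    qed
    \<comment> \<open>Splitting at an intermediate index leaves one half in \<open>\<Psi>\<close>
      with fewer indices in between, until a pair of neighbours remains.\<close>
    have "\<exists>k\<in>C. \<exists>k'\<in>C. d i \<le> d k \<and> d k < d k' \<and> d k' \<le> d j \<and> B k k' = {} \<and> v k - v k' \<in> \<Psi>"
      if "i \<in> C" "j \<in> C" "d i < d j" "v i - v j \<in> \<Psi>" for i j
      using that
    proof (induction "card (B i j)" arbitrary: i j rule: less_induct)
      case less
      show ?case
      proof (cases "B i j = {}")
        case True
        then show ?thesis using less.prems by blast
      next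
        case False
        then obtain k where k: "k \<in> B i j" by blast
        then have kC: "k \<in> C" "d i < d k" "d k < d j" by (auto simp: B_def)
        then have "i < k" "k < j" "j \<le> l" using mono less.prems by (auto simp: C_def)
        then consider "v i - v k \<in> \<Psi>" | "v k - v j \<in> \<Psi>"
          using S less.prems(4) unfolding splits_def by blast
        then show ?thesis
        proof cases
          case 1
          then show ?thesis
            using less.hyps[OF B(1)[OF k] less.prems(1) kC(1,2)] kC by (meson less_imp_le order_trans)
        next
          case 2
          then show ?thesis
            using less.hyps[OF B(2)[OF k] kC(1) less.prems(2) kC(3)] kC by (meson less_imp_le order_trans)
        qed
      qed
    qed
    moreover have "d p < d q"
      using mono[OF qC pC] inj[OF pC qC] pq(1) by (metis less_asym less_irrefl linorder_neqE)
    ultimately obtain k k' where k: "k \<in> C" "k' \<in> C" "d p \<le> d k" "d k < d k'" "d k' \<le> d q"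
      "B k k' = {}" "v k - v k' \<in> \<Psi>"
      using \<alpha> pC qC pq(3) by blast
    obtain n where n: "root_hyperplane (v k - v k') n \<in> ceilings A" "(v k - v k') \<bullet> x = of_int n"
      using consec(2)[OF k(1,2,4,6)] by blast
    \<comment> \<open>The roots from \<open>p\<close> to \<open>k\<close>, \<open>k\<close> to
      \<open>k'\<close> and \<open>k'\<close> to \<open>q\<close> add up to \<open>\<alpha>\<close>,
      and on the closure each is at most its value at \<open>x\<close>. At \<open>w\<close> the
      total is attained, hence so is each summand.\<close>
    have "w \<in> root_hyperplane (v k - v k') n" if w: "w \<in> ?F" for w
    proof -
      have wA: "w \<in> closure A" using w upper_closure_subset_closure by blast
      have le: "(v i - v j) \<bullet> w \<le> (v i - v j) \<bullet> x" if ij: "i \<in> C" "j \<in> C" "d i \<le> d j" for i j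
      proof (cases "d i = d j")
        case True
        then show ?thesis using inj[OF ij(1,2)] by simp
      next
        case False
        then have "d i < d j" using ij by simp
        then have r: "v i - v j \<in> R" using mono[OF ij(1,2)] ij(2) by (auto intro: rootI simp: C_def)
        obtain N :: int where N: "(v i - v j) \<bullet> x = of_int N" using CI[OF ij(1,2)] by (auto elim: Ints_cases)
        then have "(v i - v j) \<bullet> y < of_int N" using d[of i j] \<open>d i < d j\<close> by simp
        from closure_alcove_le(1)[OF A(1) y wA r this] show ?thesis using N by simp
      qed
      have "(v p - v q) \<bullet> w = (v p - v q) \<bullet> x" using w xm pq by (simp add: root_hyperplane_def)
      then have "(v k - v k') \<bullet> w = (v k - v k') \<bullet> x"
        using le[OF pC k(1,3)] le[OF k(1,2)] le[OF k(2) qC k(5)] k(4) by (simp add: inner_diff_left)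
      then show ?thesis using n(2) by (simp add: root_hyperplane_def)
    qed
    then show ?thesis using k(7) n(1) by blast
  qed
  then show "?F = {} \<or> (\<exists>\<beta>\<in>\<Psi>. \<exists>m'. root_hyperplane \<beta> m' \<in> ceilings A \<and> ?F \<subseteq> root_hyperplane \<beta> m')"
    by blast
qed

section \<open>From Worpitzky-compatibility to splitting\<close>

text \<open>On the closure the two summands are bounded by \<open>m\<close> and \<open>n\<close>, so
  level \<open>m + n\<close> forces both equalities. A facet there would span a hyperplane contained
  in another, different one.\<close>

lemma non_facet_root_hyperplane:
  assumes A: "A \<in> alcoves R" and y: "y \<in> A" and ikj: "i < k" "k < j" "j \<le> l"
    and yl: "(v i - v k) \<bullet> y < of_int m" "(v k - v j) \<bullet> y < of_int n"
  shows "root_hyperplane (v i - v j) (m + n) \<notin> walls A"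
proof
  assume "root_hyperplane (v i - v j) (m + n) \<in> walls A"
  then obtain F where F: "F facet_of closure A" "root_hyperplane (v i - v j) (m + n) = affine hull F"
    unfolding walls_def by blast
  have "F \<subseteq> {z. (v i - v k) \<bullet> z = of_int m}"
  proof
    fix z assume z: "z \<in> F"
    then have "z \<in> closure A" using F(1) face_of_imp_subset unfolding facet_of_def by blast
    moreover have "v i - v k \<in> R" "v k - v j \<in> R" using ikj by (auto intro: rootI)
    ultimately have "(v i - v k) \<bullet> z \<le> of_int m" "(v k - v j) \<bullet> z \<le> of_int n"
      using closure_alcove_le(1)[OF A y _ _ yl(1)] closure_alcove_le(1)[OF A y _ _ yl(2)] by blast+
    moreover have "(v i - v j) \<bullet> z = of_int (m + n)"
      using hull_inc[OF z, of affine] unfolding F(2)[symmetric] root_hyperplane_def by simp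
    ultimately show "z \<in> {z. (v i - v k) \<bullet> z = of_int m}" by (simp add: inner_diff_left)
  qed
  then have sub: "root_hyperplane (v i - v j) (m + n) \<subseteq> {z. (v i - v k) \<bullet> z = of_int m}"
    unfolding F(2) by (intro hull_minimal) (auto simp: affine_hyperplane)
  \<comment> \<open>Keeps the sum at \<open>m + n\<close> but moves the first summand to
    \<open>m + 1\<close>.\<close>
  define f :: "nat \<Rightarrow> real" where "f a = (if a = i then of_int m + 1 else if a = j then 1 - of_int n else 0)" for a
  obtain w where w: "\<And>a b. a \<le> l \<Longrightarrow> b \<le> l \<Longrightarrow> (v a - v b) \<bullet> w = f a - f b"
    using point_with_coordinates[of f] by blast
  have "w \<in> root_hyperplane (v i - v j) (m + n)"
    using w[of i j] ikj by (simp add: f_def root_hyperplane_def)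
  then show False using sub w[of i k] ikj by (auto simp: f_def)
qed

text \<open>With \<open>P = {i, k, j}\<close>, the alcove of \<open>y\<close> is chosen such that its walls through the boundary
  point \<open>x\<close> are exactly \<open>(v i - v k) \<bullet> x = 1\<close> and \<open>(v k - v j) \<bullet> x = 1\<close>, both of them ceilings:
  modulo 1, the negated coordinates of \<open>x\<close> coincide on \<open>P\<close> and are distinct elsewhere, and those
  of \<open>y\<close> break the tie.\<close>

lemma splits_if_worpitzky_compatible:
  assumes W: "worpitzky_compatible R \<Delta> \<Psi>"
  shows "splits \<Psi>"
  unfolding splits_def
proof (intro conjI allI impI)
  show sub: "\<Psi> \<subseteq> R" using W unfolding worpitzky_compatible_def by blast
  fix i k j assume "i < k \<and> k < j \<and> j \<le> l \<and> v i - v j \<in> \<Psi>"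
  then have ikj: "i < k" "k < j" "j \<le> l" and \<Psi>: "v i - v j \<in> \<Psi>" by auto
  define P where "P = {i, k, j}"
  \<comment> \<open>Large enough that the values \<open>(real a + 1) / L\<close> off
    \<open>P\<close> are at most 1/2, while the values \<open>(L - real a) / L\<close> on
    \<open>P\<close> exceed 1/2.\<close>
  define L :: real where "L = 2 * (real l + 1)"
  \<comment> \<open>The integer part jumps by 1 right after each member of \<open>P\<close>, exactly
    where \<open>g\<close> drops. This keeps every simple root strictly between 0 and 1 at
    \<open>y\<close>.\<close>
  define N :: "nat \<Rightarrow> int" where "N a = of_bool (i < a) + of_bool (k < a) + of_bool (j < a)" for a
  \<comment> \<open>On \<open>P\<close> the constant 1 makes the differences at \<open>x\<close>
    integral. There \<open>g\<close> is 1 minus \<open>a / L\<close>, decreasing in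
    \<open>a\<close>, which puts \<open>y\<close> below these levels.\<close>
  define f where "f a = (if a \<in> P then 1 else (real a + 1) / L)" for a
  define g where "g a = (if a \<in> P then (L - real a) / L else (real a + 1) / L)" for a
  have L: "0 < L" unfolding L_def by simp
  have LP: "real b + 1 < L - real a" if "a \<le> l" "b \<le> l" for a b
    using that by (simp add: L_def)
  have f01: "0 < f a" "f a \<le> 1" if "a \<le> l" for a
    using L LP[OF that that] by (auto simp: f_def)
  have g01: "0 < g a" "g a \<le> 1" if "a \<le> l" for a
    using L LP[OF that that] by (auto simp: g_def)
  have f_eq: "a \<in> P \<and> b \<in> P" if "f a = f b" "a < b" "b \<le> l" for a b
    using that L LP[of a a] LP[of b b] by (auto simp: f_def split: if_splits)
  have g_step: "if a \<in> P then g b < g a else g a < g b" if "a < b" "b \<le> l" for a b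
    using that L LP[of a b] LP[of b a]
    by (cases "a \<in> P"; cases "b \<in> P") (auto simp: g_def intro!: divide_strict_right_mono)
  \<comment> \<open>\<open>f\<close> orders the indices weakly as \<open>g\<close> does, so each
    root has \<open>x\<close> and \<open>y\<close> in a common closed unit strip.\<close>
  have fg: "g a < g b \<and> f a \<le> f b \<or> g b < g a \<and> f b \<le> f a" if "a < b" "b \<le> l" for a b
    using g_step[OF that] that L f01(2)[of a] f01(2)[of b]
    by (cases "a \<in> P"; cases "b \<in> P") (auto simp: f_def intro: divide_right_mono simp del: divide_le_eq_1_pos)
  have N_P: "N a < N b" if "a < b" "a \<in> P" for a b
    using that ikj by (auto simp: N_def P_def)
  have N_Suc: "N (Suc a) = N a + of_bool (a \<in> P)" for a
    using ikj by (auto simp: N_def P_def less_Suc_eq)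
  have N_ikj: "N i = 0" "N k = 1" "N j = 2" using ikj by (auto simp: N_def)
  obtain x where x: "\<And>a b. a \<le> l \<Longrightarrow> b \<le> l \<Longrightarrow> (v a - v b) \<bullet> x = (- N a - f a) - (- N b - f b)"
    using point_with_coordinates[of "\<lambda>a. - N a - f a"] by blast
  obtain y where y: "\<And>a b. a \<le> l \<Longrightarrow> b \<le> l \<Longrightarrow> (v a - v b) \<bullet> y = (- N a - g a) - (- N b - g b)"
    using point_with_coordinates[of "\<lambda>a. - N a - g a"] by blast
  have between: "\<exists>n::int. of_int n < \<alpha> \<bullet> y \<and> \<alpha> \<bullet> y < of_int n + 1 \<and> of_int n \<le> \<alpha> \<bullet> x \<and> \<alpha> \<bullet> x \<le> of_int n + 1"
    if "\<alpha> \<in> R" for \<alpha>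
  proof -
    obtain a b where ab: "a < b" "b \<le> l" "\<alpha> = v a - v b" using \<open>\<alpha> \<in> R\<close> by (rule rootE)
    from fg[OF ab(1,2)] show ?thesis
    proof
      assume "g a < g b \<and> f a \<le> f b"
      then show ?thesis using x[of a b] y[of a b] ab f01[of a] f01[of b] g01[of a] g01[of b]
        by (intro exI[of _ "N b - N a"]) auto
    next
      assume "g b < g a \<and> f b \<le> f a"
      then show ?thesis using x[of a b] y[of a b] ab f01[of a] f01[of b] g01[of a] g01[of b]
        by (intro exI[of _ "N b - N a - 1"]) auto
    qed
  qed
  have "\<alpha> \<bullet> y \<notin> \<int>" if "\<alpha> \<in> R" for \<alpha>
  proof
    assume "\<alpha> \<bullet> y \<in> \<int>"
    then obtain m :: int where m: "\<alpha> \<bullet> y = of_int m" by (auto elim: Ints_cases)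
    from between[OF that] obtain n :: int
      where "of_int n < (of_int m :: real)" "(of_int m :: real) < of_int (n + 1)"
      unfolding m by auto
    then have "n < m" "m < n + 1" by (simp_all only: of_int_less_iff)
    then show False by linarith
  qed
  then obtain A where A: "A \<in> alcoves R" and yA: "y \<in> A" by (rule alcove_exists)
  have "A \<subseteq> fundamental_parallelepiped \<Delta>"
  proof
    fix z assume z: "z \<in> A"
    show "z \<in> fundamental_parallelepiped \<Delta>"
      unfolding fundamental_parallelepiped_def
    proof (intro CollectI ballI)
      fix \<delta> assume "\<delta> \<in> \<Delta>"
      then obtain a where a: "a < l" "\<delta> = v a - v (Suc a)" unfolding simples by blast
      have "0 < \<delta> \<bullet> y \<and> \<delta> \<bullet> y < 1"
        using y[of a "Suc a"] a N_Suc[of a] g01[of a] g01[of "Suc a"] g_step[of a "Suc a"]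
        by (auto split: if_splits)
      moreover have \<delta>: "\<delta> \<in> R" using a by (auto intro: rootI)
      ultimately show "0 < \<delta> \<bullet> z \<and> \<delta> \<bullet> z \<le> 1"
        using alcove_strip[OF A yA z \<delta>, of 0] alcove_strip[OF A yA z \<delta>, of 1]
          alcove_disjoint_hyperplane[OF A z \<delta>, of 0] by auto
    qed
  qed
  have xA: "x \<in> closure A" using between by (rule closure_alcove_memI[OF A yA])
  have xij: "(v i - v j) \<bullet> x = of_int 2" using x[of i j] ikj N_ikj by (simp add: f_def P_def)
  have "x \<notin> A"
  proof
    assume "x \<in> A"
    moreover have "v i - v j \<in> R" using ikj by (auto intro: rootI)
    ultimately show False using xij alcove_disjoint_hyperplane[OF A] by blast
  qed
  have integral: "a \<in> P \<and> b \<in> P" if "a < b" "b \<le> l" "(v a - v b) \<bullet> x = of_int n" for a b n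
  proof -
    have "f b - f a = of_int (n - N b + N a)" using x[of a b] that by simp
    moreover have "-1 < f b - f a" "f b - f a < 1"
      using f01[of a] f01[of b] that by linarith+
    ultimately have "f b = f a" by (metis abs_less_iff diff_gt_0_iff_gt eq_iff_diff_eq_0 minus_less_iff of_int_0 of_int_1
          of_int_eq_0_iff of_int_abs of_int_less_iff zabs_less_one_iff)
    then show ?thesis using f_eq[of a b] that by simp
  qed
  have ceil: "H \<in> ceilings A" if H: "H \<in> walls A" "x \<in> H" for H
  proof -
    obtain \<beta> n where \<beta>: "\<beta> \<in> R" "H = root_hyperplane \<beta> n"
      using wall_is_root_hyperplane[OF A finite_roots zero_not_root H(1)] by blast
    obtain a b where ab: "a < b" "b \<le> l" "\<beta> = v a - v b" using \<beta>(1) by (rule rootE)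
    have xn: "(v a - v b) \<bullet> x = of_int n" using H(2) \<beta>(2) ab(3) by (simp add: root_hyperplane_def)
    then have P: "a \<in> P" "b \<in> P" using integral ab by blast+
    then have n: "n = N b - N a" using x[of a b] ab xn by (simp add: f_def flip: of_int_diff of_int_add)
    have "\<beta> \<bullet> y < of_int n" using y[of a b] g_step[OF ab(1,2)] P ab n by simp
    then have "\<forall>z\<in>A. \<beta> \<bullet> z < of_int n" using alcove_strip[OF A yA _ \<beta>(1)] by blast
    moreover have "0 < (of_int n :: real)" using N_P[OF ab(1) P(1)] n by simp
    ultimately show ?thesis
      using H(1) \<beta>(2) unfolding ceilings_def root_hyperplane_def by blast
  qed
  obtain H where H: "H \<in> walls A" "x \<in> H"
    by (rule frontier_point_on_wall[OF A finite_roots xA \<open>x \<notin> A\<close>])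
  then have "x \<in> upper_closure A"
    using ceil xA unfolding upper_closure_def by blast
  then have "x \<in> upper_closure A \<inter> root_hyperplane (v i - v j) 2"
    using xij by (simp add: root_hyperplane_def)
  then obtain \<beta> n where \<beta>: "\<beta> \<in> \<Psi>" "root_hyperplane \<beta> n \<in> ceilings A" "x \<in> root_hyperplane \<beta> n"
    using W A \<open>A \<subseteq> fundamental_parallelepiped \<Delta>\<close> \<Psi> unfolding worpitzky_compatible_def by blast
  have "\<beta> \<in> R" using \<beta>(1) sub by blast
  then obtain a b where ab: "a < b" "b \<le> l" "\<beta> = v a - v b" by (rule rootE)
  have xn: "(v a - v b) \<bullet> x = of_int n" using \<beta>(3) ab(3) by (simp add: root_hyperplane_def)
  have "a \<in> P" "b \<in> P" using integral[OF ab(1,2) xn] by auto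
  \<comment> \<open>Of the three roots supported on \<open>P\<close>, the long one is excluded since
    its hyperplane is no wall; the ceiling in \<open>\<Psi>\<close> belongs to one of the two
    halves.\<close>
  moreover have "\<not> (a = i \<and> b = j)"
  proof
    assume *: "a = i \<and> b = j"
    then have "of_int n = (of_int 2 :: real)" using xn xij by simp
    then have "n = 1 + 1" by simp
    moreover have "root_hyperplane (v i - v j) (1 + 1) \<notin> walls A"
    proof (rule non_facet_root_hyperplane[OF A yA ikj])
      show "(v i - v k) \<bullet> y < of_int 1"
        using y[of i k] g_step[of i k] ikj N_ikj by (simp add: P_def)
      show "(v k - v j) \<bullet> y < of_int 1"
        using y[of k j] g_step[of k j] ikj N_ikj by (simp add: P_def)
    qed
    ultimately show False using \<beta>(2) ab * unfolding ceilings_def by blast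
  qed
  ultimately have "a = i \<and> b = k \<or> a = k \<and> b = j" using ab ikj by (auto simp: P_def)
  then show "v i - v k \<in> \<Psi> \<or> v k - v j \<in> \<Psi>" using \<beta>(1) ab(3) by blast
qed

end

section \<open>Bases of a root system of type A\<close>

text \<open>Extend \<open>h\<close> linearly and represent the functional as an inner product by
  applying its adjoint to 1.\<close>

lemma exists_inner_on_independent:
  fixes B :: "'a::euclidean_space set" and h :: "'a \<Rightarrow> real"
  assumes "independent B"
  obtains x where "\<And>b. b \<in> B \<Longrightarrow> b \<bullet> x = h b"
proof -
  obtain g :: "'a \<Rightarrow> real" where g: "linear g" "\<forall>b\<in>B. g b = h b"
    using linear_independent_extend[OF assms] by blast
  have "g b = b \<bullet> adjoint g 1" for b
    using adjoint_works[OF g(1), of b 1] by simp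
  then show thesis using that g(2) by metis
qed

lemma root_reflection_idem:
  "\<alpha> \<noteq> 0 \<Longrightarrow> root_reflection \<alpha> (root_reflection \<alpha> x) = x"
  by (simp add: root_reflection_def inner_diff_left algebra_simps)

lemma root_system_uminus:
  assumes "root_system \<Phi>" "\<alpha> \<in> \<Phi>"
  shows "- \<alpha> \<in> \<Phi>"
proof -
  have "{c *\<^sub>R \<alpha> | c. c *\<^sub>R \<alpha> \<in> \<Phi>} = {\<alpha>, - \<alpha>}" using assms unfolding root_system_def by blast
  then have "- \<alpha> \<in> {c *\<^sub>R \<alpha> | c. c *\<^sub>R \<alpha> \<in> \<Phi>}" by simp
  then show ?thesis by auto
qed

text \<open>The usual descent: a positive root that is not simple has positive inner product with some
  simple root, and the corresponding reflection keeps it positive and lowers its height.\<close>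

lemma root_system_subset_if_closed:
  assumes \<Phi>: "root_system \<Phi>" and \<Delta>: "root_base \<Phi> \<Delta>"
    and sub: "\<Delta> \<subseteq> S" and refl: "\<And>\<delta> \<beta>. \<delta> \<in> \<Delta> \<Longrightarrow> \<beta> \<in> S \<Longrightarrow> root_reflection \<delta> \<beta> \<in> S"
    and neg: "\<And>\<beta>. \<beta> \<in> S \<Longrightarrow> - \<beta> \<in> S"
  shows "\<Phi> \<subseteq> S"
proof
  have ind: "independent \<Delta>" and \<Delta>\<Phi>: "\<Delta> \<subseteq> \<Phi>" using \<Delta> unfolding root_base_def by auto
  have fin: "finite \<Delta>" using ind by (rule finiteI_independent)
  have nz: "\<beta> \<noteq> 0" if "\<beta> \<in> \<Phi>" for \<beta> using \<Phi> that unfolding root_system_def by blast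
  \<comment> \<open>Links the computed coefficients of a reflected root to those supplied by
    \<open>root_base\<close>, which alone are known to have a common sign.\<close>
  have uniq: "c \<alpha> = c' \<alpha>" if "(\<Sum>\<alpha>\<in>\<Delta>. of_int (c \<alpha>) *\<^sub>R \<alpha>) = (\<Sum>\<alpha>\<in>\<Delta>. of_int (c' \<alpha>) *\<^sub>R \<alpha>)" "\<alpha> \<in> \<Delta>"
    for c c' :: "'a \<Rightarrow> int" and \<alpha>
  proof -
    have "(\<Sum>\<alpha>\<in>\<Delta>. of_int (c \<alpha> - c' \<alpha>) *\<^sub>R \<alpha>) = 0"
      using that(1) by (simp add: scaleR_left_diff_distrib sum_subtractf)
    then have "real_of_int (c \<alpha> - c' \<alpha>) = 0"
      by (rule independentD[OF ind fin subset_refl _ that(2)])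
    then show ?thesis by simp
  qed
  have pos: "\<beta> \<in> S" if "\<beta> \<in> \<Phi>" "\<beta> = (\<Sum>\<alpha>\<in>\<Delta>. of_int (c \<alpha>) *\<^sub>R \<alpha>)" "\<forall>\<alpha>\<in>\<Delta>. 0 \<le> c \<alpha>"
    for \<beta> and c :: "'a \<Rightarrow> int"
    using that
  proof (induction "nat (\<Sum>\<alpha>\<in>\<Delta>. c \<alpha>)" arbitrary: \<beta> c rule: less_induct)
    case less
    note c = less.prems(2) and c0 = less.prems(3)
    have "0 < \<beta> \<bullet> \<beta>" using nz less.prems(1) by simp
    also have "\<beta> \<bullet> \<beta> = (\<Sum>\<alpha>\<in>\<Delta>. of_int (c \<alpha>) * (\<alpha> \<bullet> \<beta>))" by (subst c) (simp add: inner_sum_left)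
    finally have "\<exists>\<delta>\<in>\<Delta>. 0 < of_int (c \<delta>) * (\<delta> \<bullet> \<beta>)" by (meson linorder_not_less sum_nonpos)
    then obtain \<delta> where \<delta>: "\<delta> \<in> \<Delta>" "0 < of_int (c \<delta>) * (\<delta> \<bullet> \<beta>)" by blast
    have c\<delta>: "0 < c \<delta>" "0 < \<delta> \<bullet> \<beta>" using \<delta> c0 by (auto simp: zero_less_mult_iff)
    have \<delta>\<Phi>: "\<delta> \<in> \<Phi>" "\<delta> \<noteq> 0" using \<delta>(1) \<Delta>\<Phi> nz by auto
    have "2 * (\<beta> \<bullet> \<delta>) / (\<delta> \<bullet> \<delta>) \<in> \<int>" using \<Phi> \<delta>\<Phi> less.prems(1) unfolding root_system_def by blast
    then obtain n where n: "2 * (\<beta> \<bullet> \<delta>) / (\<delta> \<bullet> \<delta>) = of_int n" by (auto elim: Ints_cases)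
    have "0 < 2 * (\<beta> \<bullet> \<delta>) / (\<delta> \<bullet> \<delta>)" using c\<delta> \<delta>\<Phi> by (simp add: inner_commute)
    then have n0: "0 < n" unfolding n by simp
    define \<beta>' where "\<beta>' = root_reflection \<delta> \<beta>"
    have "root_reflection \<delta> ` \<Phi> = \<Phi>" using \<Phi> \<delta>\<Phi> unfolding root_system_def by blast
    then have \<beta>'\<Phi>: "\<beta>' \<in> \<Phi>" using less.prems(1) unfolding \<beta>'_def by blast
    define c' where "c' = c(\<delta> := c \<delta> - n)"
    have split: "(\<Sum>\<alpha>\<in>\<Delta>. of_int (e \<alpha>) *\<^sub>R \<alpha>) = of_int (e \<delta>) *\<^sub>R \<delta> + (\<Sum>\<alpha>\<in>\<Delta> - {\<delta>}. of_int (e \<alpha>) *\<^sub>R \<alpha>)"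
      for e :: "'a \<Rightarrow> int" using sum.remove[OF fin \<delta>(1)] by blast
    have "\<beta>' = \<beta> - of_int n *\<^sub>R \<delta>" unfolding \<beta>'_def root_reflection_def n ..
    also have "\<dots> = of_int (c' \<delta>) *\<^sub>R \<delta> + (\<Sum>\<alpha>\<in>\<Delta> - {\<delta>}. of_int (c \<alpha>) *\<^sub>R \<alpha>)"
      unfolding c split[of c] by (simp add: c'_def scaleR_left_diff_distrib)
    also have "\<dots> = (\<Sum>\<alpha>\<in>\<Delta>. of_int (c' \<alpha>) *\<^sub>R \<alpha>)"
      unfolding split[of c'] by (simp add: c'_def)
    finally have c': "\<beta>' = (\<Sum>\<alpha>\<in>\<Delta>. of_int (c' \<alpha>) *\<^sub>R \<alpha>)" .
    show ?case
    \<comment> \<open>The reflection changes only the coefficient of \<open>\<delta>\<close>.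
      Another positive coefficient survives and makes the image positive; without one, the root is a
      multiple of \<open>\<delta>\<close>.\<close>
    proof (cases "\<exists>\<epsilon>\<in>\<Delta> - {\<delta>}. 0 < c \<epsilon>")
      case True
      then obtain \<epsilon> where \<epsilon>: "\<epsilon> \<in> \<Delta>" "\<epsilon> \<noteq> \<delta>" "0 < c \<epsilon>" by blast
      obtain e where e: "\<beta>' = (\<Sum>\<alpha>\<in>\<Delta>. of_int (e \<alpha>) *\<^sub>R \<alpha>)" "(\<forall>\<alpha>\<in>\<Delta>. 0 \<le> e \<alpha>) \<or> (\<forall>\<alpha>\<in>\<Delta>. e \<alpha> \<le> 0)"
        using \<Delta> \<beta>'\<Phi> unfolding root_base_def by blast
      have ec: "e \<alpha> = c' \<alpha>" if "\<alpha> \<in> \<Delta>" for \<alpha> using uniq[of e c' \<alpha>] e(1) c' that by simp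
      have "\<not> e \<epsilon> \<le> 0" using ec[OF \<epsilon>(1)] \<epsilon> by (simp add: c'_def)
      then have "\<forall>\<alpha>\<in>\<Delta>. 0 \<le> e \<alpha>" using e(2) \<epsilon>(1) by blast
      then have c'0: "\<forall>\<alpha>\<in>\<Delta>. 0 \<le> c' \<alpha>" using ec by simp
      have "sum c' \<Delta> < sum c \<Delta>"
        by (rule sum_strict_mono_ex1[OF fin]) (use n0 \<delta>(1) in \<open>auto simp: c'_def\<close>)
      moreover have "0 \<le> sum c' \<Delta>" using c'0 by (simp add: sum_nonneg)
      ultimately have "nat (sum c' \<Delta>) < nat (sum c \<Delta>)" by simp
      then have "\<beta>' \<in> S" using less.hyps \<beta>'\<Phi> c' c'0 by blast
      then have "root_reflection \<delta> \<beta>' \<in> S" by (rule refl[OF \<delta>(1)])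
      then show ?thesis unfolding \<beta>'_def by (simp add: root_reflection_idem \<delta>\<Phi>)
    next
      case False
      then have "c \<alpha> = 0" if "\<alpha> \<in> \<Delta> - {\<delta>}" for \<alpha> using c0 that by (simp add: order_antisym not_less)
      then have \<beta>: "\<beta> = of_int (c \<delta>) *\<^sub>R \<delta>" unfolding c split[of c] by simp
      then have "\<beta> \<in> {c *\<^sub>R \<delta> | c. c *\<^sub>R \<delta> \<in> \<Phi>}" using less.prems(1) by blast
      also have "\<dots> = {\<delta>, - \<delta>}" using \<Phi> \<delta>\<Phi> unfolding root_system_def by blast
      finally show ?thesis using sub \<delta>(1) neg by auto
    qed
  qed
  fix \<beta> assume \<beta>: "\<beta> \<in> \<Phi>"
  then obtain c :: "'a \<Rightarrow> int" where c: "\<beta> = (\<Sum>\<alpha>\<in>\<Delta>. of_int (c \<alpha>) *\<^sub>R \<alpha>)"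
    "(\<forall>\<alpha>\<in>\<Delta>. 0 \<le> c \<alpha>) \<or> (\<forall>\<alpha>\<in>\<Delta>. c \<alpha> \<le> 0)"
    using \<Delta> unfolding root_base_def by blast
  from c(2) show "\<beta> \<in> S"
  proof
    assume "\<forall>\<alpha>\<in>\<Delta>. 0 \<le> c \<alpha>"
    then show ?thesis using pos \<beta> c(1) by blast
  next
    assume *: "\<forall>\<alpha>\<in>\<Delta>. c \<alpha> \<le> 0"
    have "- \<beta> = (\<Sum>\<alpha>\<in>\<Delta>. of_int (- c \<alpha>) *\<^sub>R \<alpha>)" by (simp add: c(1) sum_negf)
    then have "- \<beta> \<in> S"
      using pos[of "- \<beta>" "\<lambda>\<alpha>. - c \<alpha>"] * root_system_uminus[OF \<Phi> \<beta>] by simp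
    then show ?thesis using neg by fastforce
  qed
qed

text \<open>Pairing with \<open>h\<close> gives the sum of the simple coefficients; for a positive
  root these are natural numbers, not all zero.\<close>

lemma root_base_height:
  assumes \<Phi>: "root_system \<Phi>" and \<Delta>: "root_base \<Phi> \<Delta>"
  obtains h where "\<And>\<delta>. \<delta> \<in> \<Delta> \<Longrightarrow> \<delta> \<bullet> h = 1"
    and "\<And>\<beta>. \<beta> \<in> positive_roots \<Phi> \<Delta> \<Longrightarrow> 1 \<le> \<beta> \<bullet> h"
proof -
  have ind: "independent \<Delta>" using \<Delta> unfolding root_base_def by blast
  obtain h where h: "\<And>\<delta>. \<delta> \<in> \<Delta> \<Longrightarrow> \<delta> \<bullet> h = 1"
    using exists_inner_on_independent[OF ind, of "\<lambda>_. 1"] by blast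
  have sumh: "(\<Sum>\<alpha>\<in>\<Delta>. c \<alpha> *\<^sub>R \<alpha>) \<bullet> h = (\<Sum>\<alpha>\<in>\<Delta>. c \<alpha>)" for c :: "'a \<Rightarrow> real"
    using h by (simp add: inner_sum_left)
  have "1 \<le> \<beta> \<bullet> h" if \<beta>: "\<beta> \<in> positive_roots \<Phi> \<Delta>" for \<beta>
  proof -
    obtain c :: "'a \<Rightarrow> nat" where c: "\<beta> = (\<Sum>\<alpha>\<in>\<Delta>. of_nat (c \<alpha>) *\<^sub>R \<alpha>)" and "\<beta> \<in> \<Phi>"
      using \<beta> unfolding positive_roots_def by blast
    then have "\<beta> \<noteq> 0" using \<Phi> unfolding root_system_def by blast
    then have "\<not> (\<forall>\<alpha>\<in>\<Delta>. c \<alpha> = 0)" using c by fastforce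
    then have "sum c \<Delta> \<noteq> 0" using finiteI_independent[OF ind] by simp
    then have "1 \<le> real (sum c \<Delta>)" by linarith
    then show ?thesis unfolding c sumh by simp
  qed
  then show thesis using that h by blast
qed

lemma root_positive_or_negative:
  assumes \<Phi>: "root_system \<Phi>" and \<Delta>: "root_base \<Phi> \<Delta>" and \<beta>: "\<beta> \<in> \<Phi>"
  shows "\<beta> \<in> positive_roots \<Phi> \<Delta> \<or> - \<beta> \<in> positive_roots \<Phi> \<Delta>"
proof -
  have *: "\<gamma> \<in> positive_roots \<Phi> \<Delta>"
    if "\<gamma> \<in> \<Phi>" "\<gamma> = (\<Sum>\<alpha>\<in>\<Delta>. of_int (c \<alpha>) *\<^sub>R \<alpha>)" "\<forall>\<alpha>\<in>\<Delta>. 0 \<le> c \<alpha>" for \<gamma> and c :: "'a \<Rightarrow> int"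
  proof -
    have "\<gamma> = (\<Sum>\<alpha>\<in>\<Delta>. of_nat (nat (c \<alpha>)) *\<^sub>R \<alpha>)" using that by (auto intro: sum.cong)
    then show ?thesis using that(1) unfolding positive_roots_def by (intro CollectI conjI exI)
  qed
  obtain c :: "'a \<Rightarrow> int" where c: "\<beta> = (\<Sum>\<alpha>\<in>\<Delta>. of_int (c \<alpha>) *\<^sub>R \<alpha>)"
    "(\<forall>\<alpha>\<in>\<Delta>. 0 \<le> c \<alpha>) \<or> (\<forall>\<alpha>\<in>\<Delta>. c \<alpha> \<le> 0)"
    using \<Delta> \<beta> unfolding root_base_def by blast
  have "- \<beta> = (\<Sum>\<alpha>\<in>\<Delta>. of_int (- c \<alpha>) *\<^sub>R \<alpha>)" by (simp add: c(1) sum_negf)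
  then show ?thesis
    using *[OF \<beta> c(1)] *[OF root_system_uminus[OF \<Phi> \<beta>], of "\<lambda>\<alpha>. - c \<alpha>"] c(2) by auto
qed

text \<open>With \<open>v i\<close> the negated partial sums of the simple roots, simple reflections
  swap adjacent indices. The set of differences is thus closed under them and under negation, so it
  contains \<open>\<Phi>\<close>; conversely, reflections lengthen a simple root step by step to any
  difference.\<close>

lemma type_A_root_differences:
  fixes \<Phi> :: "'a::euclidean_space set"
  assumes "root_system_type_A l \<Phi>"
  obtains v :: "nat \<Rightarrow> 'a" where "\<Phi> = {v i - v j | i j. i \<le> l \<and> j \<le> l \<and> i \<noteq> j}"
    and "\<And>f :: nat \<Rightarrow> real. \<exists>x. \<forall>i\<le>l. \<forall>j\<le>l. (v i - v j) \<bullet> x = f i - f j"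
proof -
  obtain \<Delta> \<alpha> where \<Phi>: "root_system \<Phi>" and \<Delta>: "root_base \<Phi> \<Delta>" and \<alpha>: "bij_betw \<alpha> {1..l} \<Delta>"
    and cartan: "\<forall>i\<in>{1..l}. \<forall>j\<in>{1..l}. 2 * (\<alpha> i \<bullet> \<alpha> j) / (\<alpha> j \<bullet> \<alpha> j) =
       (if i = j then 2 else if i = j + 1 \<or> j = i + 1 then -1 else 0)"
    using assms unfolding root_system_type_A_def by blast
  have ind: "independent \<Delta>" and \<Delta>\<Phi>: "\<Delta> \<subseteq> \<Phi>" using \<Delta> unfolding root_base_def by auto
  define v where "v i = - (\<Sum>k = 1..i. \<alpha> k)" for i
  have v_Suc: "v (Suc i) = v i - \<alpha> (Suc i)" for i by (simp add: v_def)
  have \<alpha>\<Delta>: "\<alpha> (Suc k) \<in> \<Delta>" if "k < l" for k using bij_betwE[OF \<alpha>] that by auto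
  have \<Delta>E: "\<exists>k<l. \<delta> = \<alpha> (Suc k)" if "\<delta> \<in> \<Delta>" for \<delta>
  proof -
    have "\<delta> \<in> \<alpha> ` {1..l}" using \<alpha> that unfolding bij_betw_def by blast
    then obtain m where "m \<in> {1..l}" "\<delta> = \<alpha> m" by blast
    then show ?thesis by (intro exI[of _ "m - 1"]) auto
  qed
  have coords: "\<exists>x. \<forall>i\<le>l. \<forall>j\<le>l. (v i - v j) \<bullet> x = f i - f j" for f :: "nat \<Rightarrow> real"
  proof -
    define g where "g = the_inv_into {1..l} \<alpha>"
    have g: "g (\<alpha> (Suc k)) = Suc k" if "k < l" for k
      unfolding g_def using \<alpha> that by (intro the_inv_into_f_f) (auto simp: bij_betw_def)
    obtain x where x: "\<And>\<delta>. \<delta> \<in> \<Delta> \<Longrightarrow> \<delta> \<bullet> x = f (g \<delta> - 1) - f (g \<delta>)"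
      using exists_inner_on_independent[OF ind, of "\<lambda>\<delta>. f (g \<delta> - 1) - f (g \<delta>)"] by blast
    have "v i \<bullet> x = f i - f 0" if "i \<le> l" for i
      using that
    proof (induction i)
      case 0 then show ?case by (simp add: v_def)
    next
      case (Suc i)
      then have "i < l" by simp
      then show ?case using Suc x[OF \<alpha>\<Delta>] g by (simp add: v_Suc inner_diff_left)
    qed
    then show ?thesis by (intro exI[of _ x]) (simp add: inner_diff_left)
  qed
  define S where "S = {v i - v j | i j. i \<le> l \<and> j \<le> l \<and> i \<noteq> j}"
  define \<tau> where "\<tau> k i = (if i = k then Suc k else if i = Suc k then k else i)" for k i :: nat
  \<comment> \<open>The term for \<open>k = 0\<close> stems from the normalisation
    \<open>v 0 = 0\<close>; being independent of \<open>i\<close>, it cancels in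
    differences.\<close>
  have pairing: "2 * (v i \<bullet> \<alpha> (Suc k)) / (\<alpha> (Suc k) \<bullet> \<alpha> (Suc k)) = of_bool (i = k) - of_bool (i = Suc k) - of_bool (k = 0)"
    if "i \<le> l" "k < l" for i k
    using that(1)
  proof (induction i)
    case 0 then show ?case by (simp add: v_def)
  next
    case (Suc i)
    have "2 * (\<alpha> (Suc i) \<bullet> \<alpha> (Suc k)) / (\<alpha> (Suc k) \<bullet> \<alpha> (Suc k)) =
       (if i = k then 2 else if i = k + 1 \<or> k = i + 1 then -1 else 0)"
      using cartan Suc.prems that(2) by auto
    then show ?case using Suc
      by (auto simp: v_Suc inner_diff_left right_diff_distrib diff_divide_distrib)
  qed
  have reflect: "root_reflection (\<alpha> (Suc k)) (v i - v j) = v (\<tau> k i) - v (\<tau> k j)"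
    if "i \<le> l" "j \<le> l" "k < l" for i j k
  proof -
    define s where "s i = (of_bool (i = k) - of_bool (i = Suc k) :: real)" for i
    have "2 * ((v i - v j) \<bullet> \<alpha> (Suc k)) / (\<alpha> (Suc k) \<bullet> \<alpha> (Suc k)) = s i - s j"
      using pairing[OF that(1,3)] pairing[OF that(2,3)]
      by (simp add: s_def inner_diff_left right_diff_distrib diff_divide_distrib)
    then have "root_reflection (\<alpha> (Suc k)) (v i - v j) = (v i - v j) - (s i - s j) *\<^sub>R \<alpha> (Suc k)"
      unfolding root_reflection_def by simp
    moreover have "v (\<tau> k m) = v m - s m *\<^sub>R \<alpha> (Suc k)" for m
      by (auto simp: \<tau>_def s_def v_Suc)
    ultimately show ?thesis by (simp add: scaleR_left_diff_distrib)
  qed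
  have \<tau>: "\<tau> k i \<le> l" "\<tau> k i = \<tau> k j \<longleftrightarrow> i = j" if "i \<le> l" "k < l" for i j k
    using that by (auto simp: \<tau>_def)
  have "\<Phi> \<subseteq> S"
  proof (rule root_system_subset_if_closed[OF \<Phi> \<Delta>])
    show "\<Delta> \<subseteq> S"
    proof
      fix \<delta> assume "\<delta> \<in> \<Delta>"
      then obtain k where "k < l" "\<delta> = \<alpha> (Suc k)" using \<Delta>E by blast
      then show "\<delta> \<in> S" unfolding S_def
        by (intro CollectI exI[of _ k] exI[of _ "Suc k"]) (simp add: v_Suc)
    qed
    show "root_reflection \<delta> \<beta> \<in> S" if "\<delta> \<in> \<Delta>" "\<beta> \<in> S" for \<delta> \<beta>
    proof -
      obtain k where k: "k < l" "\<delta> = \<alpha> (Suc k)" using \<Delta>E \<open>\<delta> \<in> \<Delta>\<close> by blast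
      obtain i j where ij: "i \<le> l" "j \<le> l" "i \<noteq> j" "\<beta> = v i - v j" using \<open>\<beta> \<in> S\<close> unfolding S_def by blast
      have "root_reflection \<delta> \<beta> = v (\<tau> k i) - v (\<tau> k j)" using reflect ij k by simp
      then show ?thesis using \<tau> ij k unfolding S_def by blast
    qed
    show "- \<beta> \<in> S" if "\<beta> \<in> S" for \<beta>
    proof -
      obtain i j where ij: "i \<le> l" "j \<le> l" "i \<noteq> j" "\<beta> = v i - v j" using \<open>\<beta> \<in> S\<close> unfolding S_def by blast
      then show ?thesis unfolding S_def by (intro CollectI exI[of _ j] exI[of _ i]) auto
    qed
  qed
  moreover have up: "v i - v j \<in> \<Phi>" if "i < j" "j \<le> l" for i j
    using that
  proof (induction j)
    case 0 then show ?case by simp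
  next
    case (Suc j)
    have k: "j < l" using Suc.prems by simp
    have \<alpha>\<Phi>: "\<alpha> (Suc j) \<in> \<Phi>" using \<alpha>\<Delta>[OF k] \<Delta>\<Phi> by blast
    show ?case
    proof (cases "i = j")
      case True
      then show ?thesis using \<alpha>\<Phi> by (simp add: v_Suc)
    next
      case False
      then have "v i - v j \<in> \<Phi>" using Suc by simp
      moreover have "root_reflection (\<alpha> (Suc j)) ` \<Phi> = \<Phi>"
        using \<Phi> \<alpha>\<Phi> unfolding root_system_def by blast
      ultimately have "root_reflection (\<alpha> (Suc j)) (v i - v j) \<in> \<Phi>" by blast
      moreover have "\<tau> j i = i" "\<tau> j j = Suc j" using False Suc.prems by (auto simp: \<tau>_def)
      ultimately show ?thesis using reflect[of i j j] Suc.prems by simp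
    qed
  qed
  have "S \<subseteq> \<Phi>"
  proof
    fix \<beta> assume "\<beta> \<in> S"
    then obtain i j where ij: "i \<le> l" "j \<le> l" "i \<noteq> j" "\<beta> = v i - v j" unfolding S_def by blast
    then show "\<beta> \<in> \<Phi>"
      using up[of i j] root_system_uminus[OF \<Phi> up[of j i]] by (cases "i < j") auto
  qed
  ultimately have "\<Phi> = S" by blast
  then show thesis using that coords unfolding S_def by blast
qed

text \<open>The height for \<open>\<Delta>\<close> vanishes on no root, so sorting the vectors by
  decreasing height makes the positive roots the differences with \<open>i < j\<close>. Simple roots
  have height 1, which leaves only neighbours.\<close>

lemma type_A_coordinates_exist:
  fixes \<Phi> \<Delta> :: "'a::euclidean_space set"
  assumes typeA: "root_system_type_A l \<Phi>" and \<Delta>: "root_base \<Phi> \<Delta>"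
  obtains v where "type_A_coordinates v l (positive_roots \<Phi> \<Delta>) \<Delta>"
proof -
  let ?P = "positive_roots \<Phi> \<Delta>"
  have \<Phi>: "root_system \<Phi>" using typeA unfolding root_system_type_A_def by blast
  obtain w :: "nat \<Rightarrow> 'a" where w: "\<Phi> = {w i - w j | i j. i \<le> l \<and> j \<le> l \<and> i \<noteq> j}"
    and coords: "\<And>f :: nat \<Rightarrow> real. \<exists>x. \<forall>i\<le>l. \<forall>j\<le>l. (w i - w j) \<bullet> x = f i - f j"
    using type_A_root_differences[OF typeA] by blast
  obtain h where h1: "\<And>\<delta>. \<delta> \<in> \<Delta> \<Longrightarrow> \<delta> \<bullet> h = 1" and h: "\<And>\<beta>. \<beta> \<in> ?P \<Longrightarrow> 1 \<le> \<beta> \<bullet> h"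
    using root_base_height[OF \<Phi> \<Delta>] by blast
  have pos: "\<beta> \<in> ?P" if "\<beta> \<in> \<Phi>" "0 < \<beta> \<bullet> h" for \<beta>
    using root_positive_or_negative[OF \<Phi> \<Delta> that(1)] h[of "- \<beta>"] that(2) by auto
  have nonzero: "\<beta> \<bullet> h \<noteq> 0" if "\<beta> \<in> \<Phi>" for \<beta>
    using root_positive_or_negative[OF \<Phi> \<Delta> that] h[of \<beta>] h[of "- \<beta>"] by auto
  define xs where "xs = sort_key (\<lambda>i. - (w i \<bullet> h)) [0..<Suc l]"
  define v where "v i = w (xs ! i)" for i
  have len: "length xs = Suc l" by (simp add: xs_def)
  have bij: "bij_betw (nth xs) {..<Suc l} {..<Suc l}"
    by (rule bij_betw_nth) (auto simp: xs_def)
  have le: "xs ! i \<le> l" if "i \<le> l" for i using bij_betwE[OF bij] that by (auto simp: less_Suc_eq_le)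
  have inj: "xs ! i \<noteq> xs ! j" if "i \<le> l" "j \<le> l" "i \<noteq> j" for i j
    using bij that unfolding bij_betw_def inj_on_def by (auto simp: less_Suc_eq_le)
  have surj: "\<exists>i\<le>l. a = xs ! i" if "a \<le> l" for a
  proof -
    have "a \<in> nth xs ` {..<Suc l}" using bij that unfolding bij_betw_def by simp
    then show ?thesis by (auto simp: less_Suc_eq_le)
  qed
  have root: "v i - v j \<in> \<Phi>" if "i \<le> l" "j \<le> l" "i \<noteq> j" for i j
    unfolding w v_def using le inj that by blast
  have dec: "0 < (v i - v j) \<bullet> h" if "i < j" "j \<le> l" for i j
  proof -
    have "sorted (map (\<lambda>i. - (w i \<bullet> h)) xs)" unfolding xs_def by (rule sorted_sort_key)
    then have "v j \<bullet> h \<le> v i \<bullet> h"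
      using sorted_nth_mono[of "map (\<lambda>i. - (w i \<bullet> h)) xs" i j] that len by (simp add: v_def)
    then show ?thesis using nonzero[OF root[of i j]] that by (simp add: inner_diff_left)
  qed
  have P: "?P = {v i - v j | i j. i < j \<and> j \<le> l}"
  proof
    show "{v i - v j | i j. i < j \<and> j \<le> l} \<subseteq> ?P"
    proof
      fix \<beta> assume "\<beta> \<in> {v i - v j | i j. i < j \<and> j \<le> l}"
      then obtain i j where "i < j" "j \<le> l" "\<beta> = v i - v j" by blast
      then show "\<beta> \<in> ?P" using pos[OF root[of i j] dec[of i j]] by simp
    qed
    show "?P \<subseteq> {v i - v j | i j. i < j \<and> j \<le> l}"
    proof
      fix \<beta> assume \<beta>: "\<beta> \<in> ?P"
      then have "\<beta> \<in> \<Phi>" unfolding positive_roots_def by blast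
      then obtain a b where ab: "a \<le> l" "b \<le> l" "a \<noteq> b" "\<beta> = w a - w b" unfolding w by blast
      obtain i where i: "i \<le> l" "a = xs ! i" using surj[OF ab(1)] by blast
      obtain j where j: "j \<le> l" "b = xs ! j" using surj[OF ab(2)] by blast
      have \<beta>v: "\<beta> = v i - v j" using ab i j by (simp add: v_def)
      have "\<not> j < i"
      proof
        assume "j < i"
        then have "0 < (v j - v i) \<bullet> h" using dec i by blast
        then show False using h[OF \<beta>] \<beta>v by (simp add: inner_diff_left)
      qed
      moreover have "i \<noteq> j" using ab i j by blast
      ultimately have "i < j" by simp
      then show "\<beta> \<in> {v i - v j | i j. i < j \<and> j \<le> l}" using \<beta>v j by blast
    qed
  qed
  have coords_v: "\<exists>x. \<forall>i\<le>l. \<forall>j\<le>l. (v i - v j) \<bullet> x = f i - f j" for f :: "nat \<Rightarrow> real"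
  proof -
    define q where "q = the_inv_into {..<Suc l} (nth xs)"
    have q: "q (xs ! i) = i" if "i \<le> l" for i
      unfolding q_def using bij that by (intro the_inv_into_f_f) (auto simp: bij_betw_def)
    obtain x where "\<forall>a\<le>l. \<forall>b\<le>l. (w a - w b) \<bullet> x = f (q a) - f (q b)"
      using coords[of "\<lambda>a. f (q a)"] by blast
    then show ?thesis using le q unfolding v_def by (intro exI[of _ x]) simp
  qed
  have sub: "\<exists>i<l. \<delta> = v i - v (Suc i)" if \<delta>: "\<delta> \<in> \<Delta>" for \<delta>
  proof -
    have "\<delta> \<in> ?P" using \<Delta> h1[OF \<delta>] \<delta> by (intro pos) (auto simp: root_base_def)
    then obtain i j where ij: "i < j" "j \<le> l" "\<delta> = v i - v j" unfolding P by blast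
    \<comment> \<open>Otherwise \<open>\<delta>\<close> is a sum of two positive roots and has
      height at least 2.\<close>
    have "\<not> Suc i < j"
    proof
      assume "Suc i < j"
      then have "v i - v (Suc i) \<in> ?P" "v (Suc i) - v j \<in> ?P"
        using ij(2) unfolding P by (fastforce simp: Suc_lessD)+
      then have "1 \<le> (v i - v (Suc i)) \<bullet> h" "1 \<le> (v (Suc i) - v j) \<bullet> h"
        by (auto dest: h)
      then show False using h1[OF \<delta>] ij by (simp add: inner_diff_left)
    qed
    then have "j = Suc i" using ij by simp
    then show ?thesis using ij by (intro exI[of _ i]) simp
  qed
  have "\<Delta> = {v i - v (Suc i) | i. i < l}"
  proof
    show "\<Delta> \<subseteq> {v i - v (Suc i) | i. i < l}" using sub by blast
    show "{v i - v (Suc i) | i. i < l} \<subseteq> \<Delta>"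
    proof
      fix \<beta> assume "\<beta> \<in> {v i - v (Suc i) | i. i < l}"
      then obtain i where i: "i < l" "\<beta> = v i - v (Suc i)" by blast
      \<comment> \<open>A step function in the index is orthogonal to every neighbour difference
        except \<open>\<beta>\<close>. If \<open>\<beta>\<close> were missing,
        \<open>\<Delta>\<close> would lie in a hyperplane and could not span.\<close>
      obtain x where x: "\<forall>a\<le>l. \<forall>b\<le>l. (v a - v b) \<bullet> x = of_bool (a \<le> i) - of_bool (b \<le> i)"
        using coords_v[of "\<lambda>a. of_bool (a \<le> i)"] by blast
      show "\<beta> \<in> \<Delta>"
      proof (rule ccontr)
        assume "\<beta> \<notin> \<Delta>"
        have "\<delta> \<bullet> x = 0" if "\<delta> \<in> \<Delta>" for \<delta>
        proof -
          obtain a where a: "a < l" "\<delta> = v a - v (Suc a)" using sub \<open>\<delta> \<in> \<Delta>\<close> by blast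
          then have "a \<noteq> i" using i \<open>\<beta> \<notin> \<Delta>\<close> \<open>\<delta> \<in> \<Delta>\<close> by blast
          then show ?thesis using x[rule_format, of a "Suc a"] a by auto
        qed
        then have "span \<Delta> \<subseteq> {z. x \<bullet> z = 0}"
          by (intro span_minimal subspace_hyperplane) (auto simp: inner_commute)
        moreover have "\<beta> \<in> span \<Delta>" using \<Delta> unfolding root_base_def by simp
        ultimately have "\<beta> \<bullet> x = 0" by (auto simp: inner_commute)
        then show False using x[rule_format, of i "Suc i"] i by simp
      qed
    qed
  qed
  then show thesis using P coords_v by (intro that[of v] type_A_coordinates.intro)
qed

theorem theorem2p6:
  fixes \<Phi> \<Phi>p \<Delta> :: "'a::euclidean_space set" and l :: nat
  assumes "root_system_type_A l \<Phi>"
    and "root_base \<Phi> \<Delta>"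
    and "\<Phi>p = positive_roots \<Phi> \<Delta>"
  shows "(\<forall>\<Psi>. worpitzky_compatible \<Phi>p \<Delta> \<Psi> \<longrightarrow> strongly_compatible \<Phi>p \<Psi>) \<and>
    {\<Psi>. worpitzky_compatible \<Phi>p \<Delta> \<Psi>} = {\<Psi>. strongly_compatible \<Phi>p \<Psi>}"
proof -
  obtain v where "type_A_coordinates v l \<Phi>p \<Delta>"
    using type_A_coordinates_exist[OF assms(1,2)] unfolding assms(3) by blast
  then interpret type_A_coordinates v l \<Phi>p \<Delta> .
  have "worpitzky_compatible \<Phi>p \<Delta> \<Psi> \<longleftrightarrow> strongly_compatible \<Phi>p \<Psi>" for \<Psi>
    using splits_if_worpitzky_compatible strongly_compatible_if_splits
      splits_if_strongly_compatible worpitzky_compatible_if_splits by blast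
  then show ?thesis by simp
qed

end
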